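(* Let $n\ge 3$ be an integer, $k>0$ a real number, and $\phi,\theta\in[0,\pi/n]$. For every integer $N\ge 0$ put $$S_N(n,k,\phi,\theta):=\sum_{\substack{j,m\ge 0\\ 2m+nj=N}}\frac{n(j+k)}{m!\,\Gamma\bigl(n(j+k)+m+1\bigr)}\,\frac{C_j^{(k)}(\cos(n\phi))\,C_j^{(k)}(\cos(n\theta))}{C_j^{(k)}(1)}.$$ Then for every integer $N\ge 0$, $$S_N(n,k,\phi,\theta)=\frac{2^N}{\Gamma(nk+N)}\sum_{\substack{m_1,\dots,m_n\ge 0\\ m_1+\dots+m_n=N}}\ \sum_{j=0}^{\min(m_1,\dots,m_n)}\frac{(k)_j(k)_j}{(2k)_j\,j!}\Bigl(-2^{2-n}\sin(n\theta)\sin(n\phi)\Bigr)^j\prod_{s=1}^n\frac{(k+j)_{m_s-j}}{(m_s-j)!}\bigl(b_s^{\theta-\phi,n}\bigr)^{m_s-j},$$ where $b_s^{\theta-\phi,n}=\cos\bigl(\theta-\phi+\tfrac{2\pi s}{n}\bigr)$ for $s=1,\dots,n$.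
   Context: All summation indices are integers. $(x)_j=x(x+1)\cdots(x+j-1)$, $(x)_0=1$, is the Pochhammer symbol. $C_j^{(k)}$ is the (non-normalized) Gegenbauer polynomial of degree $j$ and parameter $k$, given by $\sum_{j\ge0}C_j^{(k)}(x)t^j=(1-2xt+t^2)^{-k}$ for $|x|\le 1$, $|t|<1$; in particular $C_j^{(k)}(1)=(2k)_j/j!$. The convention $0^0=1$ is used. *)

theory Defs
  imports "HOL-Complex_Analysis.Complex_Analysis"
begin

text \<open>
  The Gegenbauer polynomial \<open>C\<^sub>j\<^sup>(\<^sup>k\<^sup>)(x)\<close> is the coefficient of \<open>t\<^sup>j\<close> in
  \<open>(1 - 2xt + t\<^sup>2)\<^sup>-\<^sup>k\<close>, read here as the formal power series \<open>(1 + u)\<^sup>-\<^sup>k\<close> at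
  \<open>u = - 2xt + t\<^sup>2\<close>. The lemma \<open>gegenbauer_sums\<close> below shows that the series does converge
  to that function for \<open>\<bar>x\<bar> \<le> 1\<close> and \<open>\<bar>t\<bar> < 1\<close>.
\<close>

definition gegenbauer :: "real \<Rightarrow> nat \<Rightarrow> real \<Rightarrow> real" where
  "gegenbauer k j x = fps_nth (fps_binomial (- k) oo (fps_const (- 2 * x) * fps_X + fps_X ^ 2)) j"

lemma fps_power_nth_of_real:
  fixes F :: "real fps" and G :: "complex fps"
  assumes "\<And>n. fps_nth G n = of_real (fps_nth F n)"
  shows "fps_nth (G ^ i) n = of_real (fps_nth (F ^ i) n)"
  by (induction i arbitrary: n) (simp_all add: fps_mult_nth assms)

lemma of_real_gegenbauer:
  "complex_of_real (gegenbauer k j x) =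
     fps_nth (fps_binomial (- of_real k) oo (fps_const (- 2 * of_real x) * fps_X + fps_X ^ 2)) j"
proof -
  let ?F = "fps_const (- 2 * x) * fps_X + fps_X ^ 2 :: real fps"
  let ?G = "fps_const (- 2 * of_real x) * fps_X + fps_X ^ 2 :: complex fps"
  have G: "fps_nth ?G n = of_real (fps_nth ?F n)" for n
    by (simp add: fps_X_power_nth)
  have b: "(- complex_of_real k gchoose n) = of_real (- k gchoose n)" for n
    by (simp add: gbinomial_prod_rev)
  show ?thesis
    by (simp only: gegenbauer_def fps_compose_nth fps_binomial_nth
          fps_power_nth_of_real[of ?G ?F, OF G] b of_real_sum of_real_mult)
qed

lemma gegenbauer_has_fps_expansion:
  fixes k x :: real
  shows "(\<lambda>t::complex. (1 + (- 2 * of_real x * t + t ^ 2)) powr (- of_real k)) has_fps_expansion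
           Abs_fps (\<lambda>j. of_real (gegenbauer k j x))"
proof -
  have "((\<lambda>u::complex. (1 + u) powr (- of_real k)) \<circ> (\<lambda>t. (- 2 * of_real x) * t + t ^ 2))
          has_fps_expansion
          (fps_binomial (- of_real k) oo (fps_const (- 2 * of_real x) * fps_X + fps_X ^ 2))"
    by (intro has_fps_expansion_compose has_fps_expansion_binomial_complex
        has_fps_expansion_add has_fps_expansion_cmult_left has_fps_expansion_fps_X
        has_fps_expansion_fps_X_power) simp
  also have "fps_binomial (- of_real k) oo (fps_const (- 2 * of_real x) * fps_X + fps_X ^ 2)
               = Abs_fps (\<lambda>j. complex_of_real (gegenbauer k j x))"
    by (rule fps_ext) (simp only: of_real_gegenbauer fps_nth_Abs_fps)
  finally show ?thesis by (simp add: o_def)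
qed

lemma isCont_imp_tendsto_nhds:
  assumes "isCont f a" and "f a = b"
  shows "(f \<longlongrightarrow> b) (nhds a)"
  using assms tendsto_at_iff_tendsto_nhds[of f a] by (simp add: isCont_def)

lemma powr_factor_eventually:
  fixes k :: real and z w :: complex
  shows "eventually (\<lambda>t. (1 - z * t) powr (- of_real k) * (1 - w * t) powr (- of_real k) =
           ((1 - z * t) * (1 - w * t)) powr (- of_real k)) (nhds 0)"
proof -
  have "isCont (\<lambda>t. Ln (1 - z * t) + Ln (1 - w * t)) 0"
    by (intro continuous_intros) auto
  hence "((\<lambda>t. Ln (1 - z * t) + Ln (1 - w * t)) \<longlongrightarrow> 0) (nhds 0)"
    by (rule isCont_imp_tendsto_nhds) simp
  hence "eventually (\<lambda>t. norm (Ln (1 - z * t) + Ln (1 - w * t)) < 1) (nhds 0)"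
    by (auto simp: tendsto_iff)
  moreover have "isCont (\<lambda>t. (1 - z * t) * (1 - w * t)) 0"
    by (intro continuous_intros)
  hence "((\<lambda>t. (1 - z * t) * (1 - w * t)) \<longlongrightarrow> 1) (nhds 0)"
    by (rule isCont_imp_tendsto_nhds) simp
  hence "eventually (\<lambda>t. (1 - z * t) * (1 - w * t) \<noteq> 0) (nhds 0)"
    by (rule tendsto_imp_eventually_ne) simp
  ultimately show ?thesis
  proof eventually_elim
    case (elim t)
    have "\<bar>Im (Ln (1 - z * t) + Ln (1 - w * t))\<bar> < 1"
      using elim(1) abs_Im_le_cmod[of "Ln (1 - z * t) + Ln (1 - w * t)"] by linarith
    hence "Ln ((1 - z * t) * (1 - w * t)) = Ln (1 - z * t) + Ln (1 - w * t)"
      using elim(2) pi_gt3 by (intro Ln_times_simple) auto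
    thus ?case using elim(2)
      by (auto simp: powr_def exp_add [symmetric] algebra_simps)
  qed
qed

lemma gegenbauer_sums:
  assumes "\<bar>x\<bar> \<le> 1" and "\<bar>t\<bar> < 1"
  shows "(\<lambda>j. gegenbauer k j x * t ^ j) sums (1 - 2 * x * t + t ^ 2) powr (- k)"
proof -
  define z where "z = Complex x (sqrt (1 - x ^ 2))"
  have x2: "x ^ 2 \<le> 1" using assms(1) by (simp add: abs_square_le_1)
  have nz: "norm z = 1" using x2 by (simp add: z_def cmod_def)
  have zz: "z * cnj z = 1"
    using nz by (simp add: complex_norm_square [symmetric])
  have zs: "z + cnj z = 2 * of_real x" by (simp add: z_def complex_eq_iff)
  have fac: "(1 - z * u) * (1 - cnj z * u) = 1 + (- 2 * of_real x * u + u ^ 2)" for u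
  proof -
    have "(1 - z * u) * (1 - cnj z * u) = 1 - (z + cnj z) * u + (z * cnj z) * u ^ 2"
      by (simp add: algebra_simps power2_eq_square)
    thus ?thesis by (simp add: zz zs)
  qed
  define g where
    "g = (\<lambda>u. (1 - z * u) powr (- of_real k) * (1 - cnj z * u) powr (- complex_of_real k))"
  have ev: "eventually (\<lambda>u. g u = (1 + (- 2 * of_real x * u + u ^ 2)) powr (- of_real k)) (nhds 0)"
    using powr_factor_eventually[of z k "cnj z"] by (simp only: g_def fac)
  have "g has_fps_expansion Abs_fps (\<lambda>j. of_real (gegenbauer k j x))"
    using gegenbauer_has_fps_expansion[of x k] has_fps_expansion_cong[OF ev refl] by blast
  moreover have pos: "Re (1 - v * u) > 0" if "norm u < 1" "norm v = 1" for u v :: complex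
  proof -
    have "Re (v * u) \<le> norm (v * u)" by (rule complex_Re_le_cmod)
    also have "\<dots> < 1" using that by (simp add: norm_mult)
    finally show ?thesis by simp
  qed
  have nonpos: "1 - v * u \<notin> \<real>\<^sub>\<le>\<^sub>0" if "norm u < 1" "norm v = 1" for u v :: complex
    using pos[OF that] unfolding complex_nonpos_Reals_iff by linarith
  have "g holomorphic_on eball 0 1"
    unfolding g_def using nonpos nz
    by (intro holomorphic_intros) (auto simp: in_eball_iff)
  moreover have "ereal (norm (complex_of_real t)) < 1" using assms(2) by simp
  ultimately have
    "(\<lambda>j. fps_nth (Abs_fps (\<lambda>j. of_real (gegenbauer k j x))) j * of_real t ^ j) sums g (of_real t)"
    by (rule has_fps_expansion_imp_sums_complex)
  hence *: "(\<lambda>j. complex_of_real (gegenbauer k j x * t ^ j)) sums g (of_real t)"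
    by simp
  define a where "a = 1 - z * of_real t"
  have a: "Re a > 0" unfolding a_def using assms(2) nz by (intro pos) auto
  hence a0: "a \<noteq> 0" by auto
  have a': "1 - cnj z * of_real t = cnj a" by (simp add: a_def)
  have q: "complex_of_real ((norm a) ^ 2) = of_real (1 - 2 * x * t + t ^ 2)"
    unfolding complex_norm_square a'[symmetric] unfolding a_def fac by simp
  hence q': "(norm a) ^ 2 = 1 - 2 * x * t + t ^ 2" by (simp only: of_real_eq_iff)
  have np: "a \<notin> \<real>\<^sub>\<le>\<^sub>0" using a by (simp add: complex_nonpos_Reals_iff)
  have "g (of_real t) = a powr (- of_real k) * cnj a powr (- of_real k)"
    unfolding g_def a' by (simp only: a_def)
  also have "\<dots> = exp (- of_real k * (Ln a + cnj (Ln a)))"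
    using a0 np by (simp add: powr_def cnj_Ln exp_add [symmetric] algebra_simps)
  also have "Ln a + cnj (Ln a) = of_real (2 * ln (norm a))"
    using a0 by (simp add: complex_add_cnj)
  also have "exp (- of_real k * complex_of_real (2 * ln (norm a))) = of_real ((norm a ^ 2) powr (- k))"
    using a0 by (simp add: powr_def ln_realpow exp_of_real flip: of_real_mult of_real_minus)
  finally show ?thesis
    using * by (simp only: sums_of_real_iff q')
qed

lemma gegenbauer_1: "gegenbauer k j 1 = pochhammer (2 * k) j / fact j"
proof -
  have ev: "eventually (\<lambda>u. (1 - 1 * u) powr (- of_real k) * (1 - 1 * u) powr (- of_real k) =
          (1 + (- 2 * of_real 1 * u + u ^ 2)) powr (- complex_of_real k)) (nhds 0)"
    using powr_factor_eventually[of 1 k 1]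
    by (simp add: algebra_simps power2_eq_square)
  have "((\<lambda>u::complex. (1 + u) powr (- of_real (2 * k))) \<circ> (\<lambda>u. - u)) has_fps_expansion
          (fps_binomial (- of_real (2 * k)) oo (- fps_X))"
    by (intro has_fps_expansion_compose has_fps_expansion_binomial_complex
        has_fps_expansion_minus has_fps_expansion_fps_X) simp
  also have "((\<lambda>u::complex. (1 + u) powr (- of_real (2 * k))) \<circ> (\<lambda>u. - u)) =
      (\<lambda>u. (1 - 1 * u) powr (- of_real k) * (1 - 1 * u) powr (- of_real k))"
    by (auto simp: fun_eq_iff powr_add [symmetric])
  finally have "Abs_fps (\<lambda>j. complex_of_real (gegenbauer k j 1)) =
      fps_binomial (- of_real (2 * k)) oo (- fps_X)"
    using gegenbauer_has_fps_expansion[of 1 k] has_fps_expansion_cong[OF ev refl]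
      fps_expansion_unique_complex by blast
  hence "complex_of_real (gegenbauer k j 1) = fps_nth (fps_binomial (- of_real (2 * k)) oo (- fps_X)) j"
    by (metis fps_nth_Abs_fps)
  also have "\<dots> = (-1) ^ j * (- complex_of_real (2 * k) gchoose j)"
    by (simp add: fps_compose_uminus')
  also have "\<dots> = pochhammer (of_real (2 * k)) j / fact j"
    by (simp add: gbinomial_pochhammer flip: power_mult_distrib mult.assoc)
  also have "\<dots> = of_real (pochhammer (2 * k) j / fact j)"
    by (simp add: pochhammer_of_real [symmetric])
  finally show ?thesis by (simp only: of_real_eq_iff)
qed


definition S_index :: "nat \<Rightarrow> nat \<Rightarrow> (nat \<times> nat) set" where
  "S_index n N = {(j, m). 2 * m + n * j = N}"

definition S_sum :: "nat \<Rightarrow> nat \<Rightarrow> real \<Rightarrow> real \<Rightarrow> real \<Rightarrow> real" where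
  "S_sum N n k \<phi> \<theta> =
     (\<Sum>(j, m) \<in> S_index n N.
        real n * (real j + k) / (fact m * Gamma (real n * (real j + k) + real m + 1)) *
        (gegenbauer k j (cos (real n * \<phi>)) * gegenbauer k j (cos (real n * \<theta>))
           / gegenbauer k j 1))"

text \<open>
  The tuples \<open>(m\<^sub>1, \<dots>, m\<^sub>n)\<close> are extensional functions on \<open>{1..n}\<close>, so that each tuple
  is counted once.
\<close>

definition compositions :: "nat \<Rightarrow> nat \<Rightarrow> (nat \<Rightarrow> nat) set" where
  "compositions n N = {m \<in> {1..n} \<rightarrow>\<^sub>E UNIV. (\<Sum>s = 1..n. m s) = N}"

definition b_coeff :: "real \<Rightarrow> nat \<Rightarrow> nat \<Rightarrow> real" where
  "b_coeff \<alpha> n s = cos (\<alpha> + 2 * pi * real s / real n)"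

lemma finite_S_index:
  assumes "n > 0"
  shows "finite (S_index n N)"
proof (rule finite_subset)
  show "S_index n N \<subseteq> {..N} \<times> {..N}"
  proof
    fix p assume "p \<in> S_index n N"
    then obtain j m where p: "p = (j, m)" "2 * m + n * j = N"
      by (auto simp: S_index_def)
    have "j \<le> n * j" using assms by simp
    hence "j \<le> N" "m \<le> N" using p(2) by linarith+
    thus "p \<in> {..N} \<times> {..N}" using p(1) by simp
  qed
qed auto

lemma finite_compositions: "finite (compositions n N)"
proof (rule finite_subset)
  show "compositions n N \<subseteq> {1..n} \<rightarrow>\<^sub>E {..N}"
  proof
    fix m assume m: "m \<in> compositions n N"
    have "m s \<le> N" if "s \<in> {1..n}" for s
      using member_le_sum[of s "{1..n}" m] that m by (auto simp: compositions_def)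
    with m show "m \<in> {1..n} \<rightarrow>\<^sub>E {..N}"
      by (auto simp: compositions_def PiE_iff)
  qed
qed (auto intro: finite_PiE)

end

theory Submission
  imports Defs "HOL-Computational_Algebra.Fundamental_Theorem_Algebra"
begin

text \<open>
  Write \<open>E\<close> for the mean over \<open>s \<in> [0, 1]\<close> with respect to the symmetric Beta density with
  parameter \<open>k\<close>, and let \<open>x = n\<phi>\<close>, \<open>y = n\<theta>\<close>, \<open>p = cis x\<close>, \<open>q = cis y\<close>. Since
  \<open>C\<^sub>j(cos y) / C\<^sub>j(1) = E (q s + (1 - s) / q)\<^sup>j\<close>, the generating function of
  \<open>g\<^sub>j = C\<^sub>j(cos x) C\<^sub>j(cos y) / C\<^sub>j(1)\<close> is the mean of
  \<open>(a s + b (1 - s))\<^sup>-\<^sup>k (c s + d (1 - s))\<^sup>-\<^sup>k\<close> with \<open>a = 1 - wpq\<close>, \<open>b = 1 - wp/q\<close>,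
  \<open>c = 1 - wq/p\<close>, \<open>d = 1 - w/(pq)\<close>, which equals \<open>E (ad s + bc (1 - s))\<^sup>-\<^sup>k\<close>. Expanding in
  powers of \<open>s\<close> gives, with \<open>Q(w) = bc = 1 - 2 w cos(y - x) + w\<^sup>2\<close>,
  \<open>\<Sum>\<^sub>j g\<^sub>j w\<^sup>j = \<Sum>\<^sub>i (k)\<^sub>i\<^sup>2 / ((2k)\<^sub>i i!) (- 4 w sin x sin y)\<^sup>i Q(w)\<^sup>-\<^sup>k\<^sup>-\<^sup>i\<close>.

  The multiple sum of the theorem is the coefficient of \<open>t\<^sup>N\<close> in the analogous series \<open>H(t)\<close>
  with \<open>w\<close> replaced by a multiple of \<open>t\<^sup>n\<close> and \<open>Q\<close> by \<open>\<Prod>\<^sub>s (1 - b\<^sub>s t)\<close>. At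
  \<open>t = 2u / (1 + u\<^sup>2)\<close> this product becomes \<open>Q(u\<^sup>n) / (1 + u\<^sup>2)\<^sup>n\<close>, so that
  \<open>H(t) = (1 + u\<^sup>2)\<^sup>n\<^sup>k \<Sum>\<^sub>j g\<^sub>j u\<^sup>n\<^sup>j\<close>, and Lagrange inversion turns the coefficient of \<open>t\<^sup>N\<close>
  into \<open>S\<^sub>N\<close>.
\<close>

section \<open>Powers of formal power series with constant term one\<close>

text \<open>Only meaningful for \<open>fps_nth A 0 = 1\<close>, where it is the power \<open>A\<^sup>c\<close>.\<close>

definition fps_cpow :: "'a::field_char_0 \<Rightarrow> 'a fps \<Rightarrow> 'a fps" where
  "fps_cpow c A = fps_binomial c oo (A - 1)"

lemma fps_cpow_nth_0 [simp]: "fps_nth (fps_cpow c A) 0 = 1"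
  by (simp add: fps_cpow_def)

lemma fps_cpow_add:
  assumes "fps_nth A 0 = 1"
  shows "fps_cpow (c + d) A = fps_cpow c A * fps_cpow d A"
  using assms by (simp add: fps_cpow_def fps_binomial_add_mult fps_compose_mult_distrib)

lemma fps_cpow_0 [simp]: "fps_cpow 0 A = 1"
  by (simp add: fps_cpow_def)

lemma fps_cpow_one [simp]: "fps_cpow c 1 = 1"
  by (simp add: fps_cpow_def)

lemma fps_cpow_of_nat:
  assumes "fps_nth A 0 = 1"
  shows "fps_cpow (of_nat n) A = A ^ n"
  using assms by (simp add: fps_cpow_def fps_binomial_of_nat fps_compose_add_distrib
      flip: fps_compose_power)

lemma fps_cpow_minus_one:
  assumes "fps_nth A 0 = 1"
  shows "fps_cpow (- 1) A = inverse A"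
proof -
  have "A * fps_cpow (- 1) A = fps_cpow (1 + - 1) A"
    using assms fps_cpow_of_nat[of A 1] by (subst fps_cpow_add) auto
  then have "A * fps_cpow (- 1) A = 1" by simp
  then show ?thesis by (metis fps_inverse_unique)
qed

lemma fps_cpow_diff_of_nat:
  assumes "fps_nth A 0 = 1"
  shows "fps_cpow (c - of_nat n) A = fps_cpow c A * inverse A ^ n"
proof (induction n)
  case (Suc n)
  have "fps_cpow (c - of_nat (Suc n)) A = fps_cpow ((c - of_nat n) + - 1) A"
    by (simp add: algebra_simps)
  also have "\<dots> = fps_cpow (c - of_nat n) A * fps_cpow (- 1) A"
    using assms by (rule fps_cpow_add)
  finally show ?case
    using assms by (simp only: Suc.IH fps_cpow_minus_one power_Suc2 mult.assoc)
qed simp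

lemma fps_cpow_compose:
  assumes "fps_nth A 0 = 1" "fps_nth Z 0 = 0"
  shows "fps_cpow c A oo Z = fps_cpow c (A oo Z)"
  using assms by (simp add: fps_cpow_def fps_compose_assoc[symmetric] fps_compose_sub_distrib)

text \<open>The differential equation \<open>(1 + u) B' = c B\<close> of the binomial series,
  carried along \<open>u = A - 1\<close> by the chain rule. It replaces any appeal to
  logarithms.\<close>

lemma fps_cpow_deriv:
  assumes "fps_nth A 0 = 1"
  shows "A * fps_deriv (fps_cpow c A) = fps_const c * fps_deriv A * fps_cpow c A"
proof -
  have "(1 + fps_X) * fps_deriv (fps_binomial c) = fps_const c * fps_binomial c"
    by (simp add: fps_binomial_deriv fps_divide_unit inverse_mult_eq_1' mult_ac
        mult.left_commute[of _ "inverse _"])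
  then have "((1 + fps_X) * fps_deriv (fps_binomial c)) oo (A - 1) =
      (fps_const c * fps_binomial c) oo (A - 1)"
    by simp
  then have "A * (fps_deriv (fps_binomial c) oo (A - 1)) = fps_const c * fps_cpow c A"
    using assms by (simp add: fps_compose_mult_distrib fps_compose_add_distrib fps_cpow_def)
  then show ?thesis
    using assms by (simp add: fps_cpow_def fps_compose_deriv mult_ac)
qed

text \<open>\<open>R\<close> is the quotient of the two sides, with
  \<open>fps_cpow (- c) (A * B)\<close> serving as an inverse. By \<open>fps_cpow_deriv\<close> the
  three terms of \<open>A * B * R'\<close> cancel, so \<open>R\<close> is constant, and its constant
  term is 1.\<close>

lemma fps_cpow_mult:
  fixes A B :: "'a::field_char_0 fps"
  assumes [simp]: "fps_nth A 0 = 1" "fps_nth B 0 = 1"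
  shows "fps_cpow c (A * B) = fps_cpow c A * fps_cpow c B"
proof -
  define R where "R = fps_cpow c A * fps_cpow c B * fps_cpow (- c) (A * B)"
  have "A * B * fps_deriv R =
      (A * fps_deriv (fps_cpow c A)) * B * fps_cpow c B * fps_cpow (- c) (A * B) +
      (B * fps_deriv (fps_cpow c B)) * A * fps_cpow c A * fps_cpow (- c) (A * B) +
      (A * B * fps_deriv (fps_cpow (- c) (A * B))) * fps_cpow c A * fps_cpow c B"
    unfolding R_def by (simp add: algebra_simps)
  also have "\<dots> = 0"
    by (subst (1 2 3) fps_cpow_deriv) (simp_all add: algebra_simps flip: fps_const_neg)
  finally have "fps_deriv R = 0"
    by (auto simp: mult_eq_0_iff) (use assms in force)+
  then have "R = fps_const (fps_nth R 0)" by simp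
  then have R: "R = 1" by (simp add: R_def)
  have "fps_cpow (- c) (A * B) * fps_cpow c (A * B) = 1"
    by (subst fps_cpow_add[symmetric]) auto
  then have "R * fps_cpow c (A * B) = fps_cpow c A * fps_cpow c B"
    unfolding R_def by (simp add: mult.assoc)
  then show ?thesis by (simp add: R)
qed

lemma fps_prod_nth_0:
  fixes f :: "'b \<Rightarrow> 'a::comm_ring_1 fps"
  shows "fps_nth (\<Prod>s\<in>S. f s) 0 = (\<Prod>s\<in>S. fps_nth (f s) 0)"
  by (induction S rule: infinite_finite_induct) auto

lemma fps_cpow_prod:
  fixes f :: "'b \<Rightarrow> 'a::field_char_0 fps"
  assumes "\<And>s. s \<in> S \<Longrightarrow> fps_nth (f s) 0 = 1"
  shows "fps_cpow c (\<Prod>s\<in>S. f s) = (\<Prod>s\<in>S. fps_cpow c (f s))"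
proof -
  have "fps_cpow c (\<Prod>s\<in>T. f s) = (\<Prod>s\<in>T. fps_cpow c (f s))" if "T \<subseteq> S" for T
    using that
  proof (induction T rule: infinite_finite_induct)
    case (insert x T)
    with assms have "fps_nth (f x) 0 = 1" "fps_nth (\<Prod>s\<in>T. f s) 0 = 1"
      by (auto simp: fps_prod_nth_0 subset_iff intro!: prod.neutral)
    with insert show ?case by (simp add: fps_cpow_mult)
  qed auto
  then show ?thesis by simp
qed

lemma fps_cpow_power:
  assumes "fps_nth A 0 = 1"
  shows "fps_cpow c (A ^ n) = fps_cpow (of_nat n * c) A"
proof -
  have "fps_cpow c (A ^ n) = fps_cpow c A ^ n"
    using fps_cpow_prod[of "{..<n}" "\<lambda>_. A" c] assms by simp
  also have "\<dots> = fps_cpow (of_nat n * c) A"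
    using assms by (simp add: fps_cpow_def fps_compose_power fps_binomial_power)
  finally show ?thesis .
qed

text \<open>\<open>Z ^ i\<close> starts at degree \<open>i\<close> or later, so at each degree the
  composition is a finite sum. One bound \<open>M\<close> for all degrees up to \<open>n\<close>
  allows the sums to be exchanged.\<close>

lemma fps_mult_compose_nth:
  fixes F G Z :: "'a::comm_ring_1 fps"
  assumes "fps_nth Z 0 = 0" "n \<le> M"
  shows "fps_nth (G * (F oo Z)) n = (\<Sum>i\<le>M. fps_nth F i * fps_nth (G * Z ^ i) n)"
proof -
  have "fps_nth (F oo Z) (n - l) = (\<Sum>i\<le>M. fps_nth F i * fps_nth (Z ^ i) (n - l))" for l
    unfolding fps_compose_nth atLeast0AtMost using assms
    by (intro sum.mono_neutral_left) (auto simp: startsby_zero_power_prefix)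
  then show ?thesis
    by (simp add: fps_mult_nth sum_distrib_left sum.swap[of _ "{..M}"] mult_ac)
qed

lemma fps_cpow_one_minus:
  fixes Z :: "'a::field_char_0 fps"
  shows "fps_cpow (- k) (1 - Z) = Abs_fps (\<lambda>i. pochhammer k i / fact i) oo Z"
proof (rule fps_ext)
  fix n
  have "(- Z) ^ i = fps_const ((- 1) ^ i) * Z ^ i" for i
    by (metis fps_const_neg fps_const_1_eq_1 fps_const_power power_minus)
  then have "(- k gchoose i) * fps_nth ((- Z) ^ i) n = pochhammer k i / fact i * fps_nth (Z ^ i) n" for i
    by (simp add: gbinomial_pochhammer flip: power_mult_distrib mult.assoc)
  then show "fps_nth (fps_cpow (- k) (1 - Z)) n =
      fps_nth (Abs_fps (\<lambda>i. pochhammer k i / fact i) oo Z) n"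
    by (simp add: fps_cpow_def fps_compose_nth)
qed

lemma fps_cpow_one_minus_linear_nth:
  "fps_nth (fps_cpow (- k) (1 - fps_const a * fps_X)) n = pochhammer k n / fact n * a ^ n"
  by (simp add: fps_cpow_one_minus fps_compose_linear)

section \<open>Means with respect to the symmetric Beta distribution\<close>

text \<open>A relation instead of an integral operator: it carries integrability along with the
  value. The factor \<open>Beta k k\<close> normalises the density.\<close>

definition has_beta_mean :: "real \<Rightarrow> (real \<Rightarrow> complex) \<Rightarrow> complex \<Rightarrow> bool" where
  "has_beta_mean k f v \<longleftrightarrow>
     ((\<lambda>s. (s powr (k - 1) * (1 - s) powr (k - 1)) *\<^sub>R f s) has_integral Beta k k *\<^sub>R v) {0..1}"

lemma has_beta_mean_cmult:
  assumes "has_beta_mean k f v"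
  shows "has_beta_mean k (\<lambda>s. c * f s) (c * v)"
  using has_integral_mult_right[OF assms[unfolded has_beta_mean_def], of c]
  by (simp add: has_beta_mean_def)

lemma has_beta_mean_sum:
  assumes "finite I" "\<And>i. i \<in> I \<Longrightarrow> has_beta_mean k (f i) (v i)"
  shows "has_beta_mean k (\<lambda>s. \<Sum>i\<in>I. f i s) (\<Sum>i\<in>I. v i)"
  unfolding has_beta_mean_def scaleR_right.sum
  using assms by (intro has_integral_sum) (auto simp: has_beta_mean_def)

lemma Beta_self_neq_0:
  assumes "k > 0"
  shows "Beta k k \<noteq> (0::real)"
proof -
  have "Gamma k > 0" "Gamma (k + k) > 0"
    using assms by (simp_all)
  then show ?thesis unfolding Beta_def by simp
qed

text \<open>The product formula below is obtained by evaluating the same mean in two ways.\<close>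

lemma has_beta_mean_unique:
  assumes "has_beta_mean k f v" "has_beta_mean k f w" "k > 0"
  shows "v = w"
  using has_integral_unique[OF assms(1,2)[unfolded has_beta_mean_def]] Beta_self_neq_0[OF \<open>k > 0\<close>]
  by simp

lemma Beta_shift:
  assumes "k > (0::real)"
  shows "Beta (k + real a) (k + real b) =
    Beta k k * (pochhammer k a * pochhammer k b / pochhammer (2 * k) (a + b))"
proof -
  have "k \<notin> \<int>\<^sub>\<le>\<^sub>0" "2 * k \<notin> \<int>\<^sub>\<le>\<^sub>0" using assms by (auto elim!: nonpos_Ints_cases)
  moreover have "Gamma k > 0" "Gamma (2 * k) > 0"
    using assms by simp_all
  ultimately have "pochhammer k i = Gamma (k + real i) / Gamma k"
      "pochhammer (2 * k) i = Gamma (2 * k + real i) / Gamma (2 * k)" for i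
    by (simp_all add: pochhammer_Gamma)
  moreover have "k + real a + (k + real b) = 2 * k + real (a + b)" "k + k = 2 * k"
    by simp_all
  ultimately show ?thesis
    using \<open>Gamma k > 0\<close> \<open>Gamma (2 * k) > 0\<close> by (simp only: Beta_def) simp
qed

lemma has_beta_mean_monomial:
  assumes "k > 0"
  shows "has_beta_mean k (\<lambda>s. of_real s ^ a * of_real (1 - s) ^ b)
    (pochhammer (of_real k) a * pochhammer (of_real k) b / pochhammer (2 * of_real k) (a + b))"
proof -
  have "((\<lambda>s. s powr (k + real a - 1) * (1 - s) powr (k + real b - 1)) has_integral
      Beta (k + real a) (k + real b)) {0..1}"
    using assms by (intro has_integral_Beta_real) auto
  moreover have "s powr (k + real a - 1) * (1 - s) powr (k + real b - 1) =
      s powr (k - 1) * (1 - s) powr (k - 1) * (s ^ a * (1 - s) ^ b)" if "s \<in> {0..1}" for s :: real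
  proof -
    \<comment> \<open>At \<open>x = 0\<close> both sides vanish even for \<open>i = 0\<close>,
      because \<open>0 powr r = 0\<close> for every \<open>r\<close>.\<close>
    have "x powr (k + real i - 1) = x powr (k - 1) * x ^ i" if "x \<ge> 0" for x i
    proof (cases "x = 0")
      case False
      have "x powr (k + real i - 1) = x powr (k - 1 + real i)"
        by (simp add: algebra_simps)
      with that False show ?thesis
        by (simp only: powr_add) (simp add: powr_realpow)
    qed simp
    with that show ?thesis by simp
  qed
  ultimately have "((\<lambda>s. s powr (k - 1) * (1 - s) powr (k - 1) * (s ^ a * (1 - s) ^ b))
      has_integral Beta (k + real a) (k + real b)) {0..1}"
    by (subst has_integral_cong[symmetric]) auto
  from has_integral_linear[OF this bounded_linear_of_real[where 'a = complex]]
  have "((\<lambda>s. complex_of_real (s powr (k - 1) * (1 - s) powr (k - 1) * (s ^ a * (1 - s) ^ b)))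
      has_integral complex_of_real (Beta (k + real a) (k + real b))) {0..1}"
    by (simp only: o_def)
  moreover have "complex_of_real (Beta (k + real a) (k + real b)) = Beta k k *\<^sub>R
      (pochhammer (of_real k) a * pochhammer (of_real k) b / pochhammer (2 * of_real k) (a + b))"
    using assms pochhammer_of_real[of "2 * k" "a + b", where 'a = complex]
    by (simp add: Beta_shift scaleR_conv_of_real pochhammer_of_real)
  ultimately show ?thesis
    by (simp add: has_beta_mean_def scaleR_conv_of_real)
qed

lemma has_beta_mean_power:
  assumes "k > 0"
  shows "has_beta_mean k (\<lambda>s. of_real s ^ a)
    (pochhammer (of_real k) a / pochhammer (2 * of_real k) a)"
  using has_beta_mean_monomial[OF assms, of a 0] by simp

lemma fps_cpow_conjugate_linear_nth:
  fixes k p p' :: "'a::field_char_0"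
  shows "fps_nth (fps_cpow (- k) ((1 - fps_const p * fps_X) * (1 - fps_const p' * fps_X))) j =
    (\<Sum>a\<le>j. (pochhammer k a / fact a * p ^ a) *
      (pochhammer k (j - a) / fact (j - a) * p' ^ (j - a)))"
  by (simp add: fps_cpow_mult fps_mult_nth fps_cpow_one_minus_linear_nth atLeast0AtMost)

text \<open>In the binomial expansion each monomial has mean
  \<open>(k)_a (k)_(j-a) / (2k)_j\<close>, and the binomial coefficient turns these into
  \<open>j! / (2k)_j\<close> times a Cauchy product of two binomial series. For
  \<open>q = cis y\<close>, \<open>q' = cis (- y)\<close> this is the integral representation of the
  normalised Gegenbauer polynomial.\<close>

lemma has_beta_mean_linear_power:
  assumes "k > 0"
  shows "has_beta_mean k (\<lambda>s. (q * of_real s + q' * of_real (1 - s)) ^ j)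
    (fps_nth (fps_cpow (- of_real k) ((1 - fps_const q * fps_X) * (1 - fps_const q' * fps_X))) j *
     fact j / pochhammer (2 * of_real k) j)"
proof -
  have "has_beta_mean k
      (\<lambda>s. \<Sum>a\<le>j. (of_nat (j choose a) * q ^ a * q' ^ (j - a)) * (of_real s ^ a * of_real (1 - s) ^ (j - a)))
      (\<Sum>a\<le>j. (of_nat (j choose a) * q ^ a * q' ^ (j - a)) *
        (pochhammer (of_real k) a * pochhammer (of_real k) (j - a) / pochhammer (2 * of_real k) (a + (j - a))))"
    by (rule has_beta_mean_sum, simp, rule has_beta_mean_cmult, rule has_beta_mean_monomial, rule assms)
  also have "(\<lambda>s. \<Sum>a\<le>j. (of_nat (j choose a) * q ^ a * q' ^ (j - a)) * (of_real s ^ a * of_real (1 - s) ^ (j - a))) =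
      (\<lambda>s. (q * of_real s + q' * of_real (1 - s)) ^ j)"
    by (simp add: binomial_ring power_mult_distrib mult_ac)
  also have "(\<Sum>a\<le>j. (of_nat (j choose a) * q ^ a * q' ^ (j - a)) *
        (pochhammer (of_real k) a * pochhammer (of_real k) (j - a) / pochhammer (2 * of_real k) (a + (j - a)))) =
     fps_nth (fps_cpow (- of_real k) ((1 - fps_const q * fps_X) * (1 - fps_const q' * fps_X))) j *
     fact j / pochhammer (2 * of_real k) j"
    unfolding fps_cpow_conjugate_linear_nth sum_distrib_right sum_divide_distrib
    by (intro sum.cong) (auto simp: binomial_fact)
  finally show ?thesis .
qed

text \<open>At a fixed degree only finitely many powers of \<open>s\<close> occur, so the mean is
  taken term by term. The moment \<open>(k)_i / (2k)_i\<close> of \<open>s ^ i\<close> completes the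
  binomial series to the Gauss series F(k, k; 2k; Z).\<close>

lemma has_beta_mean_fps_cpow:
  fixes D Z :: "complex fps"
  assumes "k > 0" "fps_nth Z 0 = 0"
  shows "has_beta_mean k (\<lambda>s. fps_nth (D * fps_cpow (- of_real k) (1 - fps_const (of_real s) * Z)) j)
    (fps_nth (D * (Abs_fps (\<lambda>i. pochhammer (of_real k) i ^ 2 / (pochhammer (2 * of_real k) i * fact i)) oo Z)) j)"
proof -
  have "has_beta_mean k
      (\<lambda>s. \<Sum>i\<le>j. (pochhammer (of_real k) i / fact i * fps_nth (D * Z ^ i) j) * of_real s ^ i)
      (\<Sum>i\<le>j. (pochhammer (of_real k) i / fact i * fps_nth (D * Z ^ i) j) *
        (pochhammer (of_real k) i / pochhammer (2 * of_real k) i))"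
    by (rule has_beta_mean_sum, simp, rule has_beta_mean_cmult, rule has_beta_mean_power, rule assms)
  moreover have "fps_nth (D * fps_cpow (- of_real k) (1 - fps_const (of_real s) * Z)) j =
      (\<Sum>i\<le>j. (pochhammer (of_real k) i / fact i * fps_nth (D * Z ^ i) j) * of_real s ^ i)" for s
  proof -
    have "D * (fps_const (of_real s) * Z) ^ i = fps_const (of_real s ^ i) * (D * Z ^ i)" for i
      by (simp add: power_mult_distrib mult.left_commute)
    with assms(2) show ?thesis
      by (simp only: fps_cpow_one_minus fps_mult_compose_nth[of _ j j] order_refl fps_mult_nth_0
          mult_zero_right fps_nth_Abs_fps fps_mult_left_const_nth) (simp add: mult_ac)
  qed
  ultimately show ?thesis
    using assms(2) by (simp add: fps_mult_compose_nth[of _ j j] power2_eq_square mult_ac)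
qed

section \<open>Expansions in two series and the Appell reduction\<close>

lemma sum_triangle_eq_square:
  fixes g :: "nat \<Rightarrow> nat \<Rightarrow> 'a::comm_monoid_add"
  assumes "\<And>l r. l + r > j \<Longrightarrow> g l r = 0"
  shows "(\<Sum>m\<le>j. \<Sum>l\<le>m. g l (m - l)) = (\<Sum>l\<le>j. \<Sum>r\<le>j. g l r)"
proof -
  have "(\<Sum>l\<le>j. \<Sum>r\<le>j. g l r) = (\<Sum>(l, r)\<in>{..j} \<times> {..j}. g l r)"
    by (simp add: sum.cartesian_product)
  also have "\<dots> = (\<Sum>(l, r)\<in>{(l, r). l + r \<le> j}. g l r)"
    by (intro sum.mono_neutral_right) (auto intro!: assms)
  finally show ?thesis by (simp add: sum.triangle_reindex_eq)
qed

lemma fps_nth_mult_powers_eq_0: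
  fixes D X Y :: "'a::comm_ring_1 fps"
  assumes "fps_nth X 0 = 0" "fps_nth Y 0 = 0" "l + r > j"
  shows "fps_nth (D * (X ^ l * Y ^ r)) j = 0"
proof -
  have "\<exists>U. U * fps_X = V" if "fps_nth V 0 = 0" for V :: "'a fps"
    using that by (intro exI[of _ "fps_shift 1 V"]) (auto simp: fps_eq_iff)
  then obtain U V where "X = U * fps_X" "Y = V * fps_X" using assms by metis
  then have "D * (X ^ l * Y ^ r) = (D * U ^ l * V ^ r) * fps_X ^ (l + r)"
    by (simp add: power_mult_distrib power_add mult_ac)
  then show ?thesis using assms by (simp add: fps_X_power_mult_right_nth)
qed

text \<open>
  The reduction of the Appell series \<open>F\<^sub>1(k; k, k; 2k; X, Y)\<close> to a Gauss hypergeometric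
  series: both sides have the coefficient
  \<open>(k)\<^sub>l (k)\<^sub>r (k)\<^sub>l\<^sub>+\<^sub>r / ((2k)\<^sub>l\<^sub>+\<^sub>r l! r!)\<close> at \<open>X\<^sup>l Y\<^sup>r\<close>.
\<close>

lemma beta_mean_fps_cpow_product:
  fixes D X Y :: "complex fps" and k :: real
  assumes "k > 0" and XY: "fps_nth X 0 = 0" "fps_nth Y 0 = 0"
  defines "w \<equiv> \<lambda>a. fps_cpow (- complex_of_real k) (1 - a)"
  obtains v where
    "has_beta_mean k (\<lambda>s. fps_nth (D * w (fps_const (of_real s) * X) * w (fps_const (of_real s) * Y)) j) v"
    "has_beta_mean k (\<lambda>s. fps_nth (D * w (fps_const (of_real s) * X + fps_const (of_real (1 - s)) * Y)) j) v"
proof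
  define K where "K = complex_of_real k"
  define e where "e = (\<lambda>l r. fps_nth (D * (X ^ l * Y ^ r)) j)"
  let ?v = "\<Sum>l\<le>j. \<Sum>r\<le>j. (pochhammer K l / fact l * (pochhammer K r / fact r) * e l r) *
        (pochhammer K (l + r) / pochhammer (2 * K) (l + r))"
  have "has_beta_mean k
      (\<lambda>s. \<Sum>l\<le>j. \<Sum>r\<le>j. (pochhammer K l / fact l * (pochhammer K r / fact r) * e l r) * of_real s ^ (l + r)) ?v"
    unfolding K_def 
    by (rule has_beta_mean_sum, simp, rule has_beta_mean_sum, simp, rule has_beta_mean_cmult,
        rule has_beta_mean_power, rule assms)
  moreover have "fps_nth (D * w (fps_const (of_real s) * X) * w (fps_const (of_real s) * Y)) j =
      (\<Sum>l\<le>j. \<Sum>r\<le>j. (pochhammer K l / fact l * (pochhammer K r / fact r) * e l r) * of_real s ^ (l + r))" for s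
  proof -
    define F where "F = Abs_fps (\<lambda>i. pochhammer K i / fact i)"
    have "fps_nth (D * w (fps_const (of_real s) * X) * w (fps_const (of_real s) * Y)) j =
        fps_nth ((D * (F oo (fps_const (of_real s) * Y))) * (F oo (fps_const (of_real s) * X))) j"
      unfolding w_def F_def K_def by (simp add: fps_cpow_one_minus mult_ac)
    also have "\<dots> = (\<Sum>l\<le>j. fps_nth F l *
        fps_nth ((D * (fps_const (of_real s) * X) ^ l) * (F oo (fps_const (of_real s) * Y))) j)"
      using XY by (subst fps_mult_compose_nth[of _ j j]) (auto simp: mult_ac)
    also have "\<dots> = (\<Sum>l\<le>j. fps_nth F l * (\<Sum>r\<le>j. fps_nth F r *
        fps_nth (D * (fps_const (of_real s) * X) ^ l * (fps_const (of_real s) * Y) ^ r) j))"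
      using XY by (subst fps_mult_compose_nth[of _ j j]) auto
    finally have "fps_nth (D * w (fps_const (of_real s) * X) * w (fps_const (of_real s) * Y)) j = \<dots>" .
    moreover have "fps_nth (D * (fps_const (of_real s) * X) ^ l * (fps_const (of_real s) * Y) ^ r) j =
        of_real s ^ (l + r) * e l r" for l r
    proof -
      have "D * (fps_const (of_real s) * X) ^ l * (fps_const (of_real s) * Y) ^ r =
          fps_const (of_real s ^ (l + r)) * (D * (X ^ l * Y ^ r))"
        by (simp add: power_mult_distrib power_add mult_ac flip: fps_const_mult fps_const_power)
      then show ?thesis by (simp only: e_def fps_mult_left_const_nth)
    qed
    ultimately show ?thesis
      by (simp add: F_def sum_distrib_left mult_ac)
  qed
  ultimately show "has_beta_mean k
      (\<lambda>s. fps_nth (D * w (fps_const (of_real s) * X) * w (fps_const (of_real s) * Y)) j) ?v"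
    by simp
  \<comment> \<open>The binomial coefficient of the expansion of degree \<open>m = l + r\<close>
    turns \<open>(K)_m / m!\<close> into \<open>(K)_m / (l! r!)\<close>. The roles are exchanged
    compared with the first mean: \<open>(K)_(l+r)\<close> now comes from the series, and
    \<open>(K)_l (K)_r\<close> from the moments.\<close>
  define h where "h = (\<lambda>l r. pochhammer K (l + r) / (fact l * fact r) * e l r)"
  have "has_beta_mean k
      (\<lambda>s. \<Sum>m\<le>j. \<Sum>l\<le>m. h l (m - l) * (of_real s ^ l * of_real (1 - s) ^ (m - l)))
      (\<Sum>m\<le>j. \<Sum>l\<le>m. h l (m - l) *
        (pochhammer K l * pochhammer K (m - l) / pochhammer (2 * K) (l + (m - l))))"
    unfolding K_def
    by (rule has_beta_mean_sum, simp, rule has_beta_mean_sum, simp, rule has_beta_mean_cmult,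
        rule has_beta_mean_monomial, rule assms)
  also have "(\<Sum>m\<le>j. \<Sum>l\<le>m. h l (m - l) *
        (pochhammer K l * pochhammer K (m - l) / pochhammer (2 * K) (l + (m - l)))) = ?v"
    using XY by (subst sum_triangle_eq_square)
      (auto simp: h_def e_def fps_nth_mult_powers_eq_0 mult_ac intro!: sum.cong)
  also have "(\<lambda>s. \<Sum>m\<le>j. \<Sum>l\<le>m. h l (m - l) * (of_real s ^ l * of_real (1 - s) ^ (m - l))) =
      (\<lambda>s. fps_nth (D * w (fps_const (of_real s) * X + fps_const (of_real (1 - s)) * Y)) j)"
  proof
    fix s :: real
    define A where "A = fps_const (complex_of_real s)"
    define B where "B = fps_const (complex_of_real (1 - s))"
    have "fps_nth (D * w (A * X + B * Y)) j =
        (\<Sum>m\<le>j. pochhammer K m / fact m * fps_nth (D * (A * X + B * Y) ^ m) j)"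
      unfolding w_def K_def using XY
      by (simp add: fps_cpow_one_minus fps_mult_compose_nth[of _ j j])
    moreover have "fps_nth (D * (A * X + B * Y) ^ m) j =
        (\<Sum>l\<le>m. of_nat (m choose l) * (of_real s ^ l * of_real (1 - s) ^ (m - l)) * e l (m - l))" for m
    proof -
      have "D * (A * X + B * Y) ^ m =
          (\<Sum>l\<le>m. fps_const (of_nat (m choose l) * (of_real s ^ l * of_real (1 - s) ^ (m - l))) *
            (D * (X ^ l * Y ^ (m - l))))"
        unfolding binomial_ring sum_distrib_left A_def B_def
        by (intro sum.cong)
          (simp_all add: power_mult_distrib mult_ac fps_of_nat flip: fps_const_mult fps_const_power)
      then show ?thesis by (simp only: fps_sum_nth e_def fps_mult_left_const_nth)
    qed
    ultimately show "(\<Sum>m\<le>j. \<Sum>l\<le>m. h l (m - l) * (of_real s ^ l * of_real (1 - s) ^ (m - l))) =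
        fps_nth (D * w (A * X + B * Y)) j"
      by (auto simp: h_def sum_distrib_left binomial_fact intro!: sum.cong)
  qed
  finally show "has_beta_mean k
      (\<lambda>s. fps_nth (D * w (fps_const (of_real s) * X + fps_const (of_real (1 - s)) * Y)) j) ?v" .
qed

section \<open>The product formula for Gegenbauer polynomials\<close>

lemma fps_linear_mult:
  fixes a b :: "'a::comm_ring_1"
  shows "(1 - fps_const a * fps_X) * (1 - fps_const b * fps_X) =
    1 - fps_const (a + b) * fps_X + fps_const (a * b) * fps_X ^ 2"
  by (simp add: algebra_simps power2_eq_square flip: fps_const_add fps_const_mult)

lemma gegenbauer_cos_nth:
  "complex_of_real (gegenbauer k j (cos t)) = fps_nth (fps_cpow (- of_real k)
     ((1 - fps_const (cis t) * fps_X) * (1 - fps_const (cis (- t)) * fps_X))) j"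
proof -
  have "cis t + cis (- t) = 2 * of_real (cos t)"
    by (simp add: complex_eq_iff)
  then have "fps_const (- 2 * complex_of_real (cos t)) * fps_X + fps_X ^ 2 =
      (1 - fps_const (cis t) * fps_X) * (1 - fps_const (cis (- t)) * fps_X) - 1"
    by (simp add: fps_linear_mult cis_mult flip: fps_const_neg)
  then show ?thesis
    by (simp only: of_real_gegenbauer fps_cpow_def)
qed

text \<open>Both sides are identified with the common value \<open>v\<close> of the two means in
  \<open>beta_mean_fps_cpow_product\<close>, taken with prefactor \<open>w (b * d)\<close>. The
  Gegenbauer case is \<open>p' = 1/p\<close>, \<open>q' = 1/q\<close> on the unit circle.\<close>

lemma gegenbauer_product_formula:
  fixes p p' q q' :: complex and k :: real
  assumes "k > 0"
  defines "L \<equiv> \<lambda>a b. (1 - fps_const a * fps_X) * (1 - fps_const b * fps_X)"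
  shows "fps_nth (fps_cpow (- of_real k) (L p p')) j *
      (fps_nth (fps_cpow (- of_real k) (L q q')) j * fact j / pochhammer (2 * of_real k) j) =
    fps_nth (fps_cpow (- of_real k) (L (p * q') (p' * q)) *
      (Abs_fps (\<lambda>i. pochhammer (of_real k) i ^ 2 / (pochhammer (2 * of_real k) i * fact i)) oo
        (fps_const ((p - p') * (q - q')) * fps_X * inverse (L (p * q') (p' * q))))) j"
    (is "?lhs = ?rhs")
proof -
  define w where "w = fps_cpow (- complex_of_real k)"
  define b where "b = 1 - fps_const (p * q') * fps_X"
  define d where "d = 1 - fps_const (p' * q') * fps_X"
  \<comment> \<open>With a = 1 - pqw and c = 1 - p'qw, where w is the series variable, the choices
    give bX = b - a and dY = d - c. Hence a s + b (1 - s) = b (1 - sX), and likewise for c, d and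
    Y.\<close>
  define X where "X = fps_const (p * (q - q')) * fps_X * inverse b"
  define Y where "Y = fps_const (p' * (q - q')) * fps_X * inverse d"
  \<comment> \<open>Q = bc and QZ = bc - ad. The quadratic terms of bc and ad agree, so the
    difference is linear in the series variable.\<close>
  define Q where "Q = L (p * q') (p' * q)"
  define Z where "Z = fps_const ((p - p') * (q - q')) * fps_X * inverse Q"
  have b0: "fps_nth b 0 = 1" and d0: "fps_nth d 0 = 1" and Q0: "fps_nth Q 0 = 1"
    by (simp_all add: b_def d_def Q_def L_def)
  have bX: "b * X = fps_const (p * (q - q')) * fps_X"
    using b0 by (simp add: X_def inverse_mult_eq_1' mult.left_commute[of b])
  have dY: "d * Y = fps_const (p' * (q - q')) * fps_X"
    using d0 by (simp add: Y_def inverse_mult_eq_1' mult.left_commute[of d])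
  have QZ: "Q * Z = fps_const ((p - p') * (q - q')) * fps_X"
    using Q0 by (simp add: Z_def inverse_mult_eq_1' mult.left_commute[of Q])
  have X0: "fps_nth X 0 = 0" and Y0: "fps_nth Y 0 = 0" and Z0: "fps_nth Z 0 = 0"
    by (simp_all add: X_def Y_def Z_def)
  obtain v where v1: "has_beta_mean k (\<lambda>s. fps_nth (w (b * d) * w (1 - fps_const (of_real s) * X) *
        w (1 - fps_const (of_real s) * Y)) j) v"
    and v2: "has_beta_mean k (\<lambda>s. fps_nth (w (b * d) *
        w (1 - (fps_const (of_real s) * X + fps_const (of_real (1 - s)) * Y))) j) v"
    using beta_mean_fps_cpow_product[OF \<open>k > 0\<close> X0 Y0, of "w (b * d)" j] unfolding w_def by blast

  have lhs: "has_beta_mean k (\<lambda>s. fps_nth (w (L p p')) j * (q * of_real s + q' * of_real (1 - s)) ^ j) ?lhs"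
    unfolding w_def L_def
    by (rule has_beta_mean_cmult, rule has_beta_mean_linear_power, rule assms)
  have "fps_nth (w (L p p')) j * (q * of_real s + q' * of_real (1 - s)) ^ j =
      fps_nth (w (b * d) * w (1 - fps_const (of_real s) * X) * w (1 - fps_const (of_real s) * Y)) j" for s
  proof -
    define u where "u = q * of_real s + q' * of_real (1 - s)"
    \<comment> \<open>Multiplying the coefficient of degree \<open>j\<close> by \<open>u ^ j\<close>
      rescales the variable by \<open>u\<close>. The power under the mean thus moves into the two
      linear factors.\<close>
    have "fps_nth (w (L p p')) j * u ^ j = fps_nth (w (L p p') oo (fps_const u * fps_X)) j"
      by (simp add: fps_compose_linear)
    also have "w (L p p') oo (fps_const u * fps_X) = w (L p p' oo (fps_const u * fps_X))"
      unfolding w_def by (rule fps_cpow_compose) (simp_all add: L_def)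
    also have "L p p' oo (fps_const u * fps_X) =
        (1 - fps_const p * (fps_const u * fps_X)) * (1 - fps_const p' * (fps_const u * fps_X))"
      by (simp add: L_def fps_compose_mult_distrib fps_compose_sub_distrib)
    also have "1 - fps_const p * (fps_const u * fps_X) = b * (1 - fps_const (of_real s) * X)"
    proof -
      have "b * (1 - fps_const (of_real s) * X) = b - fps_const (of_real s) * (b * X)"
        by (simp add: algebra_simps)
      also have "\<dots> = 1 - fps_const p * (fps_const u * fps_X)"
        unfolding bX unfolding b_def u_def
        by (simp add: algebra_simps flip: fps_const_add fps_const_sub fps_const_mult)
      finally show ?thesis by simp
    qed
    also have "1 - fps_const p' * (fps_const u * fps_X) = d * (1 - fps_const (of_real s) * Y)"
    proof -
      have "d * (1 - fps_const (of_real s) * Y) = d - fps_const (of_real s) * (d * Y)"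
        by (simp add: algebra_simps)
      also have "\<dots> = 1 - fps_const p' * (fps_const u * fps_X)"
        unfolding dY unfolding d_def u_def
        by (simp add: algebra_simps flip: fps_const_add fps_const_sub fps_const_mult)
      finally show ?thesis by simp
    qed
    also have "w (b * (1 - fps_const (of_real s) * X) * (d * (1 - fps_const (of_real s) * Y))) =
        w (b * d) * w (1 - fps_const (of_real s) * X) * w (1 - fps_const (of_real s) * Y)"
      unfolding w_def using b0 d0 X0 Y0
      by (simp add: fps_cpow_mult mult_ac)
    finally show ?thesis by (simp add: u_def)
  qed
  with lhs v1 have "?lhs = v"
    using has_beta_mean_unique[OF _ _ \<open>k > 0\<close>] by simp

  have rhs: "has_beta_mean k (\<lambda>s. fps_nth (w Q * w (1 - fps_const (of_real s) * Z)) j) ?rhs"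
    unfolding w_def Q_def[symmetric] Z_def[symmetric]
    using has_beta_mean_fps_cpow[OF \<open>k > 0\<close> Z0] by simp
  \<comment> \<open>Multiplying out, bd (1 - sX - (1 - s)Y) = s ad + (1 - s) bc = Q (1 -
    sZ).\<close>
  have "w (b * d) * w (1 - (fps_const (of_real s) * X + fps_const (of_real (1 - s)) * Y)) =
      w Q * w (1 - fps_const (of_real s) * Z)" for s
  proof -
    have "b * d * (1 - (fps_const (of_real s) * X + fps_const (of_real (1 - s)) * Y)) =
        b * d - fps_const (of_real s) * d * (b * X) - fps_const (of_real (1 - s)) * b * (d * Y)"
      by (simp add: algebra_simps)
    also have "\<dots> = Q - fps_const (of_real s) * (Q * Z)"
      unfolding bX dY QZ unfolding b_def d_def Q_def L_def
    proof -
      define P P' R R' S where coeffs: "P = fps_const p" "P' = fps_const p'" "R = fps_const q"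
        "R' = fps_const q'" "S = fps_const (complex_of_real s)"
      have "(1 - P * R' * fps_X) * (1 - P' * R' * fps_X) - S * (1 - P' * R' * fps_X) * (P * (R - R') * fps_X)
          - (1 - S) * (1 - P * R' * fps_X) * (P' * (R - R') * fps_X) =
        (1 - P * R' * fps_X) * (1 - P' * R * fps_X) - S * ((P - P') * (R - R') * fps_X)"
        by (simp add: algebra_simps)
      then show "(1 - fps_const (p * q') * fps_X) * (1 - fps_const (p' * q') * fps_X) -
          fps_const (of_real s) * (1 - fps_const (p' * q') * fps_X) * (fps_const (p * (q - q')) * fps_X) -
          fps_const (of_real (1 - s)) * (1 - fps_const (p * q') * fps_X) * (fps_const (p' * (q - q')) * fps_X) =
        (1 - fps_const (p * q') * fps_X) * (1 - fps_const (p' * q) * fps_X) -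
          fps_const (of_real s) * (fps_const ((p - p') * (q - q')) * fps_X)"
        by (simp add: coeffs flip: fps_const_mult fps_const_sub)
    qed
    also have "\<dots> = Q * (1 - fps_const (of_real s) * Z)"
      by (simp add: algebra_simps)
    finally have eq: "b * d * (1 - (fps_const (of_real s) * X + fps_const (of_real (1 - s)) * Y)) =
        Q * (1 - fps_const (of_real s) * Z)" .
    have "w (b * d) * w (1 - (fps_const (of_real s) * X + fps_const (of_real (1 - s)) * Y)) =
        w (b * d * (1 - (fps_const (of_real s) * X + fps_const (of_real (1 - s)) * Y)))"
      unfolding w_def using b0 d0 X0 Y0 by (subst fps_cpow_mult[symmetric]) simp_all
    also have "\<dots> = w Q * w (1 - fps_const (of_real s) * Z)"
      unfolding w_def eq using Q0 Z0 by (subst fps_cpow_mult[symmetric]) simp_all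
    finally show ?thesis .
  qed
  with rhs v2 have "?rhs = v"
    using has_beta_mean_unique[OF _ _ \<open>k > 0\<close>] by simp
  with \<open>?lhs = v\<close> show ?thesis by simp
qed

text \<open>The value \<open>(2k)_j / j!\<close> at 1 makes the second factor of the product formula
  the normalised polynomial. The constant is (2i sin x)(2i sin y) = -4 sin x sin y.\<close>

lemma gegenbauer_product_nth:
  fixes k x y :: real
  assumes "k > 0"
  defines "Q \<equiv> (1 - fps_const (cis (y - x)) * fps_X) * (1 - fps_const (cis (x - y)) * fps_X)"
  shows "complex_of_real (gegenbauer k j (cos x) * gegenbauer k j (cos y) / gegenbauer k j 1) =
    fps_nth (fps_cpow (- of_real k) Q *
      (Abs_fps (\<lambda>i. pochhammer (of_real k) i ^ 2 / (pochhammer (2 * of_real k) i * fact i)) oo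
        (fps_const (- 4 * of_real (sin x) * of_real (sin y)) * fps_X * inverse Q))) j"
proof -
  have c: "(cis x - cis (- x)) * (cis y - cis (- y)) = - 4 * of_real (sin x) * of_real (sin y)"
    by (simp add: complex_eq_iff)
  have Q: "(1 - fps_const (cis x * cis (- y)) * fps_X) * (1 - fps_const (cis (- x) * cis y) * fps_X) = Q"
    by (simp add: Q_def cis_mult mult.commute)
  have "complex_of_real (pochhammer (2 * k) j) = pochhammer (2 * of_real k) j"
    using pochhammer_of_real[of "2 * k" j, where 'a = complex] by simp
  then have "complex_of_real (gegenbauer k j (cos x) * gegenbauer k j (cos y) / gegenbauer k j 1) =
      complex_of_real (gegenbauer k j (cos x)) *
      (complex_of_real (gegenbauer k j (cos y)) * fact j / pochhammer (2 * of_real k) j)"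
    by (simp add: gegenbauer_1)
  also note gegenbauer_cos_nth[of k j x]
  also note gegenbauer_cos_nth[of k j y]
  also note gegenbauer_product_formula[OF \<open>k > 0\<close>, of "cis x" "cis (- x)" j "cis y" "cis (- y)", unfolded Q c]
  finally show ?thesis .
qed

section \<open>The substitution \<open>t = 2u / (1 + u\<^sup>2)\<close>\<close>

text \<open>The polynomial X^n - 1 shares no root with its derivative, so it is monic with simple
  roots and splits into the corresponding linear factors.\<close>

lemma prod_diff_roots_unity:
  fixes w :: complex
  assumes "n > 0"
  shows "(\<Prod>z | z ^ n = 1. w - z) = w ^ n - 1"
proof -
  define p :: "complex poly" where "p = monom 1 n - 1"
  have p: "poly p z = z ^ n - 1" for z by (simp add: p_def poly_monom)
  have "coeff p n = 1" using assms by (simp add: p_def)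
  moreover have "degree p \<le> n"
    unfolding p_def by (intro degree_diff_le) (auto simp: degree_monom_le)
  ultimately have deg: "degree p = n"
    by (metis le_antisym le_degree zero_neq_one)
  have "pderiv p = monom (of_nat n) (n - 1)" by (simp add: p_def pderiv_diff pderiv_monom)
  then have "rsquarefree p"
    unfolding rsquarefree_roots using assms by (auto simp: p poly_monom power_0_left)
  from complex_poly_decompose_rsquarefree[OF this]
  have "p = (\<Prod>z | z ^ n = 1. [:- z, 1:])"
    by (simp add: deg \<open>coeff p n = 1\<close> p)
  then have "poly p w = (\<Prod>z | z ^ n = 1. w - z)"
    by (simp add: poly_prod)
  then show ?thesis by (simp add: p)
qed

text \<open>The identity is first proved for polynomials by comparing values, where inverting the
  nonzero argument reduces it to \<open>prod_diff_roots_unity\<close>; \<open>fps_of_poly\<close>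
  then transfers it to power series.\<close>

lemma prod_fps_one_minus_cis:
  assumes "n > 0"
  shows "(\<Prod>i<n. 1 - fps_const (cis (\<alpha> + 2 * pi * real i / real n)) * fps_X) =
    1 - fps_const (cis (real n * \<alpha>)) * fps_X ^ n"
proof -
  define c where "c = cis \<alpha>"
  have cn: "c ^ n = cis (real n * \<alpha>)" by (simp add: c_def Complex.DeMoivre)
  have "(\<Prod>z | z ^ n = 1. [:1, - (c * z):]) = 1 - monom (c ^ n) n"
  proof (rule poly_ext)
    fix y
    have "(\<Prod>z | z ^ n = 1. 1 - x * z) = 1 - x ^ n" for x :: complex
    proof (cases "x = 0")
      case False
      have "(\<Prod>z | z ^ n = 1. 1 - x * z) = (\<Prod>z | z ^ n = 1. x * (inverse x - z))"
        using False by (intro prod.cong) (auto simp: field_simps)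
      also have "\<dots> = x ^ n * (inverse x ^ n - 1)"
        using assms by (simp add: prod.distrib prod_diff_roots_unity card_roots_unity_eq)
      also have "\<dots> = 1 - x ^ n"
        using False by (simp add: field_simps)
      finally show ?thesis .
    qed (use assms in auto)
    from this[of "c * y"]
    show "poly (\<Prod>z | z ^ n = 1. [:1, - (c * z):]) y = poly (1 - monom (c ^ n) n) y"
      by (simp add: poly_prod poly_monom power_mult_distrib mult_ac)
  qed
  then have "fps_of_poly (\<Prod>z | z ^ n = 1. [:1, - (c * z):]) = fps_of_poly (1 - monom (c ^ n) n)"
    by simp
  then have "(\<Prod>z | z ^ n = 1. 1 - fps_const (c * z) * fps_X) = 1 - fps_const (c ^ n) * fps_X ^ n"
    by (simp add: fps_of_poly_prod fps_of_poly_linear' fps_of_poly_diff fps_of_poly_monom flip: fps_const_neg)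
  also have "(\<Prod>z | z ^ n = 1. 1 - fps_const (c * z) * fps_X) =
      (\<Prod>i<n. 1 - fps_const (c * cis (2 * pi * real i / real n)) * fps_X)"
    using assms by (intro prod.reindex_bij_betw[symmetric] Complex.bij_betw_roots_unity)
  finally show ?thesis by (simp add: c_def cn[unfolded c_def] cis_mult)
qed

text \<open>The index range moves to that of the theorem because the factors at 0 and
  \<open>n\<close> agree by periodicity. For the conjugate factors the reflection of
  \<open>s\<close> to \<open>n - s\<close> leads back to the previous lemma at
  \<open>- \<alpha>\<close>.\<close>

lemma prod_fps_one_minus_cis_atLeastAtMost:
  assumes "n > 0"
  shows "(\<Prod>s = 1..n. 1 - fps_const (cis (\<alpha> + 2 * pi * real s / real n)) * fps_X) =
      1 - fps_const (cis (real n * \<alpha>)) * fps_X ^ n"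
    and "(\<Prod>s = 1..n. 1 - fps_const (cis (- (\<alpha> + 2 * pi * real s / real n))) * fps_X) =
      1 - fps_const (cis (- (real n * \<alpha>))) * fps_X ^ n"
proof -
  define f where "f = (\<lambda>\<beta> s. 1 - fps_const (cis (\<beta> + 2 * pi * real s / real n)) * fps_X)"
  have "f \<alpha> n = f \<alpha> 0"
    using assms by (simp add: f_def cis_mult[symmetric])
  then have "(\<Prod>i<n. f \<alpha> (Suc i)) = (\<Prod>i<n. f \<alpha> i)"
    using prod.lessThan_Suc_shift[of "f \<alpha>" "n"] prod.lessThan_Suc[of "f \<alpha>" n]
    by (simp add: f_def mult.commute)
  then show "(\<Prod>s = 1..n. 1 - fps_const (cis (\<alpha> + 2 * pi * real s / real n)) * fps_X) =
      1 - fps_const (cis (real n * \<alpha>)) * fps_X ^ n"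
    using prod_fps_one_minus_cis[OF assms, of \<alpha>] prod.atLeast1_atMost_eq[of "f \<alpha>" n]
    by (simp add: f_def)
  have "1 - fps_const (cis (- (\<alpha> + 2 * pi * real (Suc i) / real n))) * fps_X = f (- \<alpha>) (n - Suc i)"
    if "i < n" for i
  proof -
    have "- \<alpha> + 2 * pi * real (n - Suc i) / real n = - (\<alpha> + 2 * pi * real (Suc i) / real n) + 2 * pi"
      using that by (simp add: field_simps del: of_nat_Suc)
    then have "cis (- \<alpha> + 2 * pi * real (n - Suc i) / real n) =
        cis (- (\<alpha> + 2 * pi * real (Suc i) / real n))"
      by (simp only: cis_mult[symmetric] cis_2pi mult_1_right)
    then show ?thesis by (simp only: f_def)
  qed
  then have "(\<Prod>s = 1..n. 1 - fps_const (cis (- (\<alpha> + 2 * pi * real s / real n))) * fps_X) =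
      (\<Prod>i<n. f (- \<alpha>) (n - Suc i))"
    by (simp add: prod.atLeast1_atMost_eq del: of_nat_Suc)
  also have "\<dots> = 1 - fps_const (cis (- (real n * \<alpha>))) * fps_X ^ n"
    using prod_fps_one_minus_cis[OF assms, of "- \<alpha>"]
    by (simp only: prod.nat_diff_reindex) (simp add: f_def)
  finally show "(\<Prod>s = 1..n. 1 - fps_const (cis (- (\<alpha> + 2 * pi * real s / real n))) * fps_X) =
      1 - fps_const (cis (- (real n * \<alpha>))) * fps_X ^ n" .
qed

section \<open>Lagrange inversion through binomial coefficients\<close>

text \<open>The case \<open>M = 0\<close> is split off because truncated subtraction would make
  \<open>M div 2 - 1\<close> equal to 0 there and subtract a spurious 1.\<close>

lemma fps_cpow_one_plus_X2_nth:
  "fps_nth (fps_cpow e (1 + fps_X ^ 2) * (1 - fps_X ^ 2)) M =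
    (if even M then (e gchoose (M div 2)) - (if M = 0 then 0 else e gchoose (M div 2 - 1)) else 0)"
proof -
  have f: "fps_nth (fps_cpow e (1 + fps_X ^ 2)) i = (if even i then e gchoose (i div 2) else 0)" for i
    by (simp add: fps_cpow_def fps_nth_compose_X_power)
  have "fps_nth (fps_cpow e (1 + fps_X ^ 2) * (1 - fps_X ^ 2)) M =
      fps_nth (fps_cpow e (1 + fps_X ^ 2)) M -
      (if M < 2 then 0 else fps_nth (fps_cpow e (1 + fps_X ^ 2)) (M - 2))"
    by (simp add: right_diff_distrib fps_X_power_mult_right_nth)
  moreover have "even M \<Longrightarrow> M < 2 \<longleftrightarrow> M = 0" by (auto elim: evenE)
  moreover have "\<not> M < 2 \<Longrightarrow> even (M - 2) \<longleftrightarrow> even M" "(M - 2) div 2 = M div 2 - 1" by auto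
  ultimately show ?thesis by (auto simp: f)
qed

text \<open>For \<open>M = 2 * m > 0\<close> the coefficient is binom(2m-1, m) - binom(2m-1, m-1),
  which vanishes by symmetry; for odd \<open>M\<close> it vanishes by parity.\<close>

lemma fps_cpow_one_plus_X2_nth_delta:
  "fps_nth (fps_cpow (of_nat M - 1 :: 'a::field_char_0) (1 + fps_X ^ 2) * (1 - fps_X ^ 2)) M =
    (if M = 0 then 1 else 0)"
proof (cases "even M \<and> M \<noteq> 0")
  case True
  then obtain m where M: "M = 2 * m" and "m > 0" by (auto elim!: evenE)
  have "(of_nat M - 1 :: 'a) = of_nat (2 * m - 1)"
    using M \<open>m > 0\<close> by simp
  moreover have "(2 * m - 1) choose m = (2 * m - 1) choose (m - 1)"
    using \<open>m > 0\<close> by (subst binomial_symmetric) (auto intro: arg_cong)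
  ultimately show ?thesis
    using M \<open>m > 0\<close> unfolding fps_cpow_one_plus_X2_nth by (simp flip: binomial_gbinomial del: of_nat_diff)
qed (auto simp: fps_cpow_one_plus_X2_nth)

text \<open>Lagrange inversion for the substitution \<open>t = 2u / (1 + u\<^sup>2)\<close>.\<close>

lemma fps_lagrange_one_plus_X2:
  fixes H :: "'a::field_char_0 fps"
  defines "W \<equiv> 1 + fps_X ^ 2"
  shows "fps_nth (fps_cpow (of_nat N - 1) W * (1 - fps_X ^ 2) *
      (H oo (fps_const 2 * fps_X * inverse W))) N = 2 ^ N * fps_nth H N"
proof -
  have W0: "fps_nth W 0 = 1" by (simp add: W_def)
  \<comment> \<open>For t = 2u / (1 + u^2) the weight is 2^N u^(N+1) t^(-N-1) dt/du, whence the
    factor 1 - u^2. The \<open>i\<close>-th power of t lowers the degree and the exponent of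
    \<open>W\<close> by \<open>i\<close> alike, so the delta lemma applies with
    \<open>M = N - i\<close>.\<close>
  have "fps_nth (fps_cpow (of_nat N - 1) W * (1 - fps_X ^ 2) * (fps_const 2 * fps_X * inverse W) ^ i) N =
      (if i = N then 2 ^ N else 0)" if "i \<le> N" for i
  proof -
    have "fps_cpow (of_nat N - 1) W * (1 - fps_X ^ 2) * (fps_const 2 * fps_X * inverse W) ^ i =
        fps_const (2 ^ i) * (fps_X ^ i * ((fps_cpow (of_nat N - 1) W * inverse W ^ i) * (1 - fps_X ^ 2)))"
      by (simp add: power_mult_distrib mult_ac flip: fps_const_power)
    also have "fps_cpow (of_nat N - 1) W * inverse W ^ i = fps_cpow (of_nat (N - i) - 1) W"
    proof -
      have "(of_nat (N - i) - 1 :: 'a) = (of_nat N - 1) - of_nat i"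
        using that by simp
      then show ?thesis using W0 by (simp only: fps_cpow_diff_of_nat)
    qed
    finally show ?thesis
      using that by (simp only: fps_mult_left_const_nth fps_X_power_mult_nth W_def
          fps_cpow_one_plus_X2_nth_delta) auto
  qed
  then have "(\<Sum>i\<le>N. fps_nth H i * fps_nth (fps_cpow (of_nat N - 1) W * (1 - fps_X ^ 2) *
      (fps_const 2 * fps_X * inverse W) ^ i) N) = (\<Sum>i\<le>N. if i = N then 2 ^ N * fps_nth H i else 0)"
    by (intro sum.cong) auto
  then show ?thesis
    by (subst fps_mult_compose_nth[of _ N N]) simp_all
qed

text \<open>Since (a - m) binom(a-1, m-1) = m binom(a-1, m), the difference is binom(a-1, m) times
  (a - 2m)/(a - m). At a = nk + N with N = 2m + nj the left side is the Gamma weight in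
  \<open>S_sum\<close>.\<close>

lemma gbinomial_diff_eq_Gamma:
  fixes a :: real
  assumes "a > real m"
  shows "(a - 2 * real m) / (fact m * Gamma (a - real m + 1)) =
    ((a - 1 gchoose m) - (if m = 0 then 0 else a - 1 gchoose (m - 1))) / Gamma a"
proof -
  define c where "c = a - real m"
  have c: "c > 0" using assms by (simp add: c_def)
  then have nz: "Gamma c \<noteq> 0" "Gamma a \<noteq> 0"
    using Gamma_real_pos[of c] Gamma_real_pos[of a] assms by linarith+
  have "c \<notin> \<int>\<^sub>\<le>\<^sub>0" using c by (auto elim!: nonpos_Ints_cases)
  then have "pochhammer c m = Gamma a / Gamma c"
    by (simp add: pochhammer_Gamma c_def)
  then have g: "(a - 1 gchoose m) = Gamma a / (Gamma c * fact m)"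
    by (simp add: gbinomial_pochhammer' c_def)
  define D where "D = (a - 1 gchoose m) - (if m = 0 then 0 else a - 1 gchoose (m - 1))"
  have "c * D =
      (a - 2 * real m) * (a - 1 gchoose m)"
  proof (cases m)
    case (Suc i)
    have "c * (a - 1 gchoose i) = real m * (a - 1 gchoose m)"
      using gbinomial_mult_1[of "a - 1" i] by (simp add: Suc c_def algebra_simps)
    then show ?thesis by (simp add: D_def Suc c_def algebra_simps)
  qed (simp add: D_def c_def)
  moreover have "Gamma (c + 1) = c * Gamma c"
    using c Gamma_plus1[of c] \<open>c \<notin> \<int>\<^sub>\<le>\<^sub>0\<close> by simp
  ultimately show ?thesis
    using nz c unfolding D_def[symmetric] unfolding c_def[symmetric] g by (simp add: field_simps)
qed

text \<open>On the index set \<open>j\<close> determines \<open>m\<close>. The form over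
  \<open>j\<close> up to \<open>N\<close> matches the truncated composition in
  \<open>fps_mult_compose_nth\<close>.\<close>

lemma sum_S_index:
  fixes h :: "nat \<Rightarrow> nat \<Rightarrow> 'a::comm_monoid_add"
  assumes "n > 0"
  shows "(\<Sum>(j, m)\<in>S_index n N. h j m) =
    (\<Sum>j\<le>N. if n * j \<le> N \<and> even (N - n * j) then h j ((N - n * j) div 2) else 0)"
proof -
  have "(\<Sum>j\<le>N. if n * j \<le> N \<and> even (N - n * j) then h j ((N - n * j) div 2) else 0) =
      (\<Sum>j\<in>{j\<in>{..N}. n * j \<le> N \<and> even (N - n * j)}. h j ((N - n * j) div 2))"
    by (rule sum.inter_filter[symmetric]) simp
  also have "\<dots> = (\<Sum>(j, m)\<in>S_index n N. h j m)"
  proof (rule sum.reindex_bij_witness[where i = fst and j = "\<lambda>j. (j, (N - n * j) div 2)"])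
    fix p assume "p \<in> S_index n N"
    then obtain j m where p: "p = (j, m)" and jm: "2 * m + n * j = N"
      by (auto simp: S_index_def)
    then have eq: "N - n * j = 2 * m" "n * j \<le> N" by auto
    moreover have "j \<le> n * j" using assms by simp
    ultimately have "j \<le> N" by linarith
    with eq show "fst p \<in> {j \<in> {..N}. n * j \<le> N \<and> even (N - n * j)}"
      "(fst p, (N - n * fst p) div 2) = p"
      by (simp_all add: p del: even_diff_nat)
  qed (auto simp: S_index_def simp del: even_diff_nat)
  finally show ?thesis by simp
qed

text \<open>Each factor becomes W (1 - b_s t) = 1 - 2 b_s u + u^2, which splits into two conjugate
  linear factors in u. Both products over \<open>s\<close> are then root of unity products.\<close>

lemma b_coeff_prod_substitution:
  fixes \<alpha> :: real
  defines "W \<equiv> 1 + fps_X ^ 2 :: complex fps"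
  assumes "n > 0"
  shows "W ^ n * ((\<Prod>s = 1..n. 1 - fps_const (of_real (b_coeff \<alpha> n s)) * fps_X) oo
      (fps_const 2 * fps_X * inverse W)) =
    ((1 - fps_const (cis (real n * \<alpha>)) * fps_X) * (1 - fps_const (cis (- (real n * \<alpha>))) * fps_X)) oo fps_X ^ n"
proof -
  define \<tau> where "\<tau> = fps_const 2 * fps_X * inverse W"
  have W0: "fps_nth W 0 = 1" by (simp add: W_def)
  have \<tau>: "fps_nth \<tau> 0 = 0" "W * \<tau> = fps_const 2 * fps_X"
    using W0 by (simp_all add: \<tau>_def inverse_mult_eq_1' mult.left_commute[of W])
  have "W ^ n * ((\<Prod>s = 1..n. 1 - fps_const (of_real (b_coeff \<alpha> n s)) * fps_X) oo \<tau>) =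
      (\<Prod>s = 1..n. W * (1 - fps_const (of_real (b_coeff \<alpha> n s)) * \<tau>))"
    using \<tau> by (simp add: prod.distrib fps_compose_prod_distrib fps_compose_sub_distrib
        fps_compose_mult_distrib)
  also have "\<dots> = (\<Prod>s = 1..n. (1 - fps_const (cis (\<alpha> + 2 * pi * real s / real n)) * fps_X) *
      (1 - fps_const (cis (- (\<alpha> + 2 * pi * real s / real n))) * fps_X))"
  proof (rule prod.cong)
    fix s
    define \<beta> where "\<beta> = \<alpha> + 2 * pi * real s / real n"
    have c: "cis \<beta> + cis (- \<beta>) = of_real (b_coeff \<alpha> n s) * 2"
    proof -
      have "b_coeff \<alpha> n s = cos \<beta>" by (simp add: b_coeff_def \<beta>_def)
      then show ?thesis by (simp add: complex_eq_iff)
    qed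
    have "W * (1 - fps_const (of_real (b_coeff \<alpha> n s)) * \<tau>) =
        W - fps_const (of_real (b_coeff \<alpha> n s)) * (W * \<tau>)"
      by (simp add: algebra_simps)
    also have "\<dots> = (1 - fps_const (cis \<beta>) * fps_X) * (1 - fps_const (cis (- \<beta>)) * fps_X)"
      unfolding fps_linear_mult c \<tau> by (simp add: W_def cis_mult mult.assoc flip: fps_const_mult)
    finally show "W * (1 - fps_const (of_real (b_coeff \<alpha> n s)) * \<tau>) =
        (1 - fps_const (cis (\<alpha> + 2 * pi * real s / real n)) * fps_X) *
        (1 - fps_const (cis (- (\<alpha> + 2 * pi * real s / real n))) * fps_X)"
      by (simp add: \<beta>_def)
  qed simp
  also have "\<dots> = (1 - fps_const (cis (real n * \<alpha>)) * fps_X ^ n) *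
      (1 - fps_const (cis (- (real n * \<alpha>))) * fps_X ^ n)"
    using \<open>n > 0\<close> by (simp only: prod.distrib prod_fps_one_minus_cis_atLeastAtMost)
  also have "\<dots> = ((1 - fps_const (cis (real n * \<alpha>)) * fps_X) *
      (1 - fps_const (cis (- (real n * \<alpha>))) * fps_X)) oo fps_X ^ n"
    using \<open>n > 0\<close> by (simp add: fps_compose_mult_distrib fps_compose_sub_distrib)
  finally show ?thesis by (simp add: \<tau>_def)
qed

text \<open>By \<open>PQ\<close> the composed base is Q(u^n) / W^n, so its power of exponent -K
  contributes W^(nK). In the argument of \<open>F\<close> that W^n cancels the denominator of
  \<open>\<tau> ^ n\<close>, and only 2^n remains.\<close>

lemma fps_cpow_substitution:
  fixes P Q F W \<tau> :: "'a::field_char_0 fps" and K A :: 'a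
  assumes "n > 0" and W0: "fps_nth W 0 = 1" and P0: "fps_nth P 0 = 1" and Q0: "fps_nth Q 0 = 1"
  defines "\<tau> \<equiv> fps_const 2 * fps_X * inverse W"
  assumes PQ: "W ^ n * (P oo \<tau>) = Q oo fps_X ^ n"
  shows "(fps_cpow (- K) P * (F oo (fps_const A * fps_X ^ n * inverse P))) oo \<tau> =
    fps_cpow (of_nat n * K) W *
      ((fps_cpow (- K) Q * (F oo (fps_const (A * 2 ^ n) * fps_X * inverse Q))) oo fps_X ^ n)"
proof -
  have \<tau>0: "fps_nth \<tau> 0 = 0" by (simp add: \<tau>_def)
  have X0: "fps_nth (fps_X ^ n :: 'a fps) 0 = 0" using \<open>n > 0\<close> by simp
  have Wn0: "fps_nth (W ^ n) 0 = 1" using W0 by (simp add: fps_nth_power_0)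
  have P\<tau>0: "fps_nth (P oo \<tau>) 0 = 1" using P0 by simp
  have "fps_cpow (of_nat n * K) W * fps_cpow (- K) (Q oo fps_X ^ n) =
      fps_cpow (of_nat n * K) W * (fps_cpow (- K) (W ^ n) * fps_cpow (- K) (P oo \<tau>))"
    using Wn0 P\<tau>0 by (simp only: fps_cpow_mult flip: PQ)
  also have "\<dots> = (fps_cpow (of_nat n * K) W * fps_cpow (of_nat n * (- K)) W) * fps_cpow (- K) (P oo \<tau>)"
    using W0 by (simp only: fps_cpow_power mult.assoc)
  also have "fps_cpow (of_nat n * K) W * fps_cpow (of_nat n * (- K)) W = 1"
    using W0 by (simp flip: fps_cpow_add)
  finally have 1: "fps_cpow (- K) P oo \<tau> = fps_cpow (of_nat n * K) W * (fps_cpow (- K) Q oo fps_X ^ n)"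
    using P0 Q0 \<tau>0 X0 by (simp add: fps_cpow_compose)
  have "(fps_const A * fps_X ^ n * inverse P) oo \<tau> = fps_const A * \<tau> ^ n * inverse (P oo \<tau>)"
    using P0 \<tau>0 by (simp add: fps_compose_mult_distrib fps_compose_power[symmetric] fps_inverse_compose)
  also have "\<dots> = fps_const (A * 2 ^ n) * fps_X ^ n * inverse (W ^ n * (P oo \<tau>))"
    by (simp add: \<tau>_def power_mult_distrib fps_inverse_mult fps_inverse_power mult_ac
        flip: fps_const_mult fps_const_power)
  also have "\<dots> = (fps_const (A * 2 ^ n) * fps_X * inverse Q) oo fps_X ^ n"
    using Q0 X0 unfolding PQ by (simp add: fps_compose_mult_distrib fps_inverse_compose)
  finally have 2: "(fps_const A * fps_X ^ n * inverse P) oo \<tau> =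
      (fps_const (A * 2 ^ n) * fps_X * inverse Q) oo fps_X ^ n" .
  have "(F oo (fps_const A * fps_X ^ n * inverse P)) oo \<tau> =
      (F oo (fps_const (A * 2 ^ n) * fps_X * inverse Q)) oo fps_X ^ n"
    using \<open>n > 0\<close> \<tau>0 X0 by (simp add: fps_compose_assoc[symmetric] 2)
  then show ?thesis
    using \<tau>0 X0 by (simp add: fps_compose_mult_distrib 1 mult.assoc)
qed

section \<open>Coefficient extraction\<close>

lemma S_sum_eq_fps_nth:
  fixes n N :: nat and k \<phi> \<theta> :: real
  assumes "n > 0" and "k > 0"
  defines "g \<equiv> \<lambda>j. gegenbauer k j (cos (real n * \<phi>)) * gegenbauer k j (cos (real n * \<theta>)) / gegenbauer k j 1"
  shows "complex_of_real (Gamma (real n * k + real N) * S_sum N n k \<phi> \<theta>) =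
    fps_nth (fps_cpow (of_nat n * of_real k + of_nat N - 1) (1 + fps_X ^ 2) * (1 - fps_X ^ 2) *
      (Abs_fps (\<lambda>j. of_real (g j)) oo fps_X ^ n)) N"
proof -
  define a where "a = real n * k + real N"
  \<comment> \<open>\<open>d m\<close> is the coefficient of u^(2m) in (1 + u^2)^(a-1) (1 - u^2). It
    is paired with u^(nj) from the composed series, where 2m + nj = N.\<close>
  define d where "d = (\<lambda>m. (a - 1 gchoose m) - (if m = 0 then 0 else a - 1 gchoose (m - 1)))"
  have a: "a > real N" using assms by (simp add: a_def)
  then have "Gamma a > 0" by simp
  have term_eq: "Gamma a * (real n * (real j + k) / (fact m * Gamma (real n * (real j + k) + real m + 1))) = d m"
    if "2 * m + n * j = N" for j m
  proof -
    have N: "real N = 2 * real m + real n * real j" using that by (simp flip: of_nat_mult of_nat_add)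
    have "real n * (real j + k) = a - 2 * real m" "a - 2 * real m + real m + 1 = a - real m + 1"
      by (simp_all add: a_def N algebra_simps)
    moreover have "a > real m"
    proof -
      have "m \<le> N" using that by simp
      then show ?thesis using a by linarith
    qed
    ultimately have "real n * (real j + k) / (fact m * Gamma (real n * (real j + k) + real m + 1)) = d m / Gamma a"
      using gbinomial_diff_eq_Gamma[of m a] by (simp only: d_def)
    then show ?thesis
      using \<open>Gamma a > 0\<close> by simp
  qed
  have "Gamma a * S_sum N n k \<phi> \<theta> = (\<Sum>(j, m)\<in>S_index n N. d m * g j)"
    unfolding S_sum_def sum_distrib_left
  proof (rule sum.cong)
    fix p assume "p \<in> S_index n N"
    then obtain j m where p: "p = (j, m)" and jm: "2 * m + n * j = N"
      by (auto simp: S_index_def)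
    show "Gamma a * (case p of (j, m) \<Rightarrow>
        real n * (real j + k) / (fact m * Gamma (real n * (real j + k) + real m + 1)) *
        (gegenbauer k j (cos (real n * \<phi>)) * gegenbauer k j (cos (real n * \<theta>)) / gegenbauer k j 1)) =
      (case p of (j, m) \<Rightarrow> d m * g j)"
      by (simp only: p prod.case g_def mult.assoc flip: term_eq[OF jm])
  qed simp
  also have "\<dots> = (\<Sum>j\<le>N. if n * j \<le> N \<and> even (N - n * j) then d ((N - n * j) div 2) * g j else 0)"
    by (rule sum_S_index) fact
  finally have "complex_of_real (Gamma a * S_sum N n k \<phi> \<theta>) =
      (\<Sum>j\<le>N. complex_of_real (if n * j \<le> N \<and> even (N - n * j) then d ((N - n * j) div 2) * g j else 0))"
    by (simp only: of_real_sum)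
  also have "\<dots> = (\<Sum>j\<le>N. of_real (g j) * fps_nth (fps_cpow (of_real a - 1) (1 + fps_X ^ 2) *
      (1 - fps_X ^ 2) * (fps_X ^ n) ^ j) N)"
  proof (rule sum.cong)
    fix j
    have "complex_of_real (a - 1) gchoose i = of_real (a - 1 gchoose i)" for i
      by (simp add: gbinomial_prod_rev)
    then have "complex_of_real (d m) = (of_real a - 1 gchoose m) - (if m = 0 then 0 else of_real a - 1 gchoose (m - 1))" for m
      by (simp add: d_def)
    moreover have "fps_nth (fps_cpow (of_real a - 1) (1 + fps_X ^ 2) * (1 - fps_X ^ 2) * (fps_X ^ n) ^ j) N =
        (if N < n * j then 0 else
          fps_nth (fps_cpow (complex_of_real a - 1) (1 + fps_X ^ 2) * (1 - fps_X ^ 2)) (N - n * j))"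
      by (simp only: power_mult[symmetric] fps_X_power_mult_right_nth)
    ultimately show "complex_of_real (if n * j \<le> N \<and> even (N - n * j) then d ((N - n * j) div 2) * g j else 0) =
      of_real (g j) * fps_nth (fps_cpow (of_real a - 1) (1 + fps_X ^ 2) *
        (1 - fps_X ^ 2) * (fps_X ^ n) ^ j) N"
      unfolding fps_cpow_one_plus_X2_nth by (auto simp: not_less simp del: even_diff_nat)
  qed simp
  also have "\<dots> = fps_nth (fps_cpow (of_real a - 1) (1 + fps_X ^ 2) * (1 - fps_X ^ 2) *
      (Abs_fps (\<lambda>j. of_real (g j)) oo fps_X ^ n)) N"
    using assms by (subst fps_mult_compose_nth[of _ N N]) auto
  finally show ?thesis by (simp add: a_def)
qed

text \<open>A tuple \<open>m\<close> corresponds to the multiset containing each \<open>s\<close>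
  with multiplicity \<open>m s\<close>; \<open>restrict\<close> makes the count function
  extensional.\<close>

lemma fps_prod_nth_compositions:
  fixes f :: "nat \<Rightarrow> 'a::comm_ring_1 fps"
  shows "fps_nth (\<Prod>s = 1..n. f s) N = (\<Sum>m\<in>compositions n N. \<Prod>s = 1..n. fps_nth (f s) (m s))"
proof -
  have "fps_nth (\<Prod>s = 1..n. f s) N =
      (\<Sum>X\<in>multisets_of_size {1..n} N. \<Prod>s = 1..n. fps_nth (f s) (count X s))"
    by (rule fps_prod_nth') simp
  also have "\<dots> = (\<Sum>m\<in>compositions n N. \<Prod>s = 1..n. fps_nth (f s) (m s))"
  proof (rule sum.reindex_bij_witness[where i = "\<lambda>m. \<Sum>s = 1..n. replicate_mset (m s) s"
        and j = "\<lambda>X. restrict (count X) {1..n}"])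
    fix X assume X: "X \<in> multisets_of_size {1..n} N"
    have "count (\<Sum>s = 1..n. replicate_mset (restrict (count X) {1..n} s) s) x = count X x" for x
      using X by (auto simp: count_sum multisets_of_size_def count_eq_zero_iff subset_iff)
    then show "(\<Sum>s = 1..n. replicate_mset (restrict (count X) {1..n} s) s) = X"
      by (intro multiset_eqI)
    have "size X = (\<Sum>s = 1..n. count X s)"
      unfolding size_multiset_overloaded_eq using X
      by (intro sum.mono_neutral_left) (auto simp: multisets_of_size_def count_eq_zero_iff)
    then show "restrict (count X) {1..n} \<in> compositions n N"
      using X by (simp add: compositions_def multisets_of_size_def)
    show "(\<Prod>s = 1..n. fps_nth (f s) (restrict (count X) {1..n} s)) =
        (\<Prod>s = 1..n. fps_nth (f s) (count X s))"
      by simp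
  next
    fix m assume m: "m \<in> compositions n N"
    show "restrict (count (\<Sum>s = 1..n. replicate_mset (m s) s)) {1..n} = m"
      using m by (auto simp: compositions_def count_sum PiE_iff extensional_def restrict_def fun_eq_iff)
    show "(\<Sum>s = 1..n. replicate_mset (m s) s) \<in> multisets_of_size {1..n} N"
      using m by (auto simp: compositions_def multisets_of_size_def size_multiset_sum set_mset_sum
          split: if_splits)
  qed
  finally show ?thesis .
qed

text \<open>In the \<open>j\<close>-th term X^(nj) is distributed as one X^j per factor, and
  P^(-K-j) factors over \<open>s\<close>. Only compositions with every \<open>m s\<close> at least
  \<open>j\<close> survive, which is the bound \<open>Min\<close>.\<close>

lemma composition_sum_eq_fps_nth:
  fixes K A :: "'a::field_char_0" and b :: "nat \<Rightarrow> 'a"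
  assumes "n > 0"
  defines "P \<equiv> \<Prod>s = 1..n. 1 - fps_const (b s) * fps_X"
  shows "fps_nth (fps_cpow (- K) P * (F oo (fps_const A * fps_X ^ n * inverse P))) N =
    (\<Sum>m\<in>compositions n N. \<Sum>j = 0..Min (m ` {1..n}).
       fps_nth F j * A ^ j * (\<Prod>s = 1..n. pochhammer (K + of_nat j) (m s - j) / fact (m s - j) * b s ^ (m s - j)))"
proof -
  have P0: "fps_nth P 0 = 1"
    by (simp add: P_def fps_prod_nth_0)
  \<comment> \<open>The case \<open>m < j\<close> is set to 0 explicitly; truncated subtraction
    would give the factor 1 instead.\<close>
  define h where "h = (\<lambda>j m s. if m < j then 0 else pochhammer (K + of_nat j) (m - j) / fact (m - j) * b s ^ (m - j))"
  have "fps_cpow (- K) P * (fps_const A * fps_X ^ n * inverse P) ^ j =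
      fps_const (A ^ j) * (\<Prod>s = 1..n. fps_X ^ j * fps_cpow (- (K + of_nat j)) (1 - fps_const (b s) * fps_X))" for j
  proof -
    have "fps_cpow (- K) P * (fps_const A * fps_X ^ n * inverse P) ^ j =
        fps_const (A ^ j) * (fps_X ^ (n * j) * (fps_cpow (- K) P * inverse P ^ j))"
      by (simp only: power_mult_distrib power_mult fps_const_power) (simp only: mult_ac)
    also have "fps_cpow (- K) P * inverse P ^ j = fps_cpow (- (K + of_nat j)) P"
      using fps_cpow_diff_of_nat[OF P0, of "- K" j] by simp
    also have "\<dots> = (\<Prod>s = 1..n. fps_cpow (- (K + of_nat j)) (1 - fps_const (b s) * fps_X))"
      unfolding P_def by (rule fps_cpow_prod) simp
    also have "fps_X ^ (n * j) = (\<Prod>s = 1..n. fps_X ^ j :: 'a fps)"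
      by (simp add: power_mult[symmetric] mult.commute)
    finally show ?thesis by (simp only: prod.distrib)
  qed
  moreover have "fps_nth (fps_X ^ j * fps_cpow (- (K + of_nat j)) (1 - fps_const (b s) * fps_X)) m = h j m s" for j m s
    by (simp only: fps_X_power_mult_nth fps_cpow_one_minus_linear_nth h_def)
  ultimately have "fps_nth (fps_cpow (- K) P * (fps_const A * fps_X ^ n * inverse P) ^ j) N =
      A ^ j * (\<Sum>m\<in>compositions n N. \<Prod>s = 1..n. h j (m s) s)" for j
    by (simp only: fps_mult_left_const_nth fps_prod_nth_compositions)
  then have "fps_nth (fps_cpow (- K) P * (F oo (fps_const A * fps_X ^ n * inverse P))) N =
      (\<Sum>j\<le>N. \<Sum>m\<in>compositions n N. fps_nth F j * A ^ j * (\<Prod>s = 1..n. h j (m s) s))"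
    using assms by (subst fps_mult_compose_nth[of _ N N]) (auto simp: sum_distrib_left mult.assoc)
  also have "\<dots> = (\<Sum>m\<in>compositions n N. \<Sum>j\<le>N. fps_nth F j * A ^ j * (\<Prod>s = 1..n. h j (m s) s))"
    by (rule sum.swap)
  also have "\<dots> = (\<Sum>m\<in>compositions n N. \<Sum>j = 0..Min (m ` {1..n}).
       fps_nth F j * A ^ j * (\<Prod>s = 1..n. pochhammer (K + of_nat j) (m s - j) / fact (m s - j) * b s ^ (m s - j)))"
  proof (rule sum.cong)
    fix m assume m: "m \<in> compositions n N"
    have Min: "j \<le> Min (m ` {1..n}) \<longleftrightarrow> (\<forall>s\<in>{1..n}. j \<le> m s)" for j
      using \<open>n > 0\<close> by (subst Min_ge_iff) auto
    have "m 1 \<le> N"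
      using m \<open>n > 0\<close> member_le_sum[of 1 "{1..n}" m] by (auto simp: compositions_def)
    then have sub: "{0..Min (m ` {1..n})} \<subseteq> {..N}"
      using \<open>n > 0\<close> Min by force
    have "(\<Sum>j\<le>N. fps_nth F j * A ^ j * (\<Prod>s = 1..n. h j (m s) s)) =
        (\<Sum>j = 0..Min (m ` {1..n}). fps_nth F j * A ^ j * (\<Prod>s = 1..n. h j (m s) s))"
    proof (rule sum.mono_neutral_right)
      show "\<forall>j\<in>{..N} - {0..Min (m ` {1..n})}. fps_nth F j * A ^ j * (\<Prod>s = 1..n. h j (m s) s) = 0"
      proof
        fix j assume "j \<in> {..N} - {0..Min (m ` {1..n})}"
        then have "\<not> j \<le> Min (m ` {1..n})" by simp
        then obtain s where "s \<in> {1..n}" "m s < j" unfolding Min by (auto simp: not_le)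
        then have "(\<Prod>s = 1..n. h j (m s) s) = 0"
          by (intro prod_zero) (auto simp: h_def)
        then show "fps_nth F j * A ^ j * (\<Prod>s = 1..n. h j (m s) s) = 0" by simp
      qed
    qed (use sub in auto)
    also have "\<dots> = (\<Sum>j = 0..Min (m ` {1..n}).
       fps_nth F j * A ^ j * (\<Prod>s = 1..n. pochhammer (K + of_nat j) (m s - j) / fact (m s - j) * b s ^ (m s - j)))"
      using Min by (intro sum.cong refl arg_cong2[where f = "(*)"] prod.cong) (auto simp: h_def not_less)
    finally show "(\<Sum>j\<le>N. fps_nth F j * A ^ j * (\<Prod>s = 1..n. h j (m s) s)) = \<dots>" .
  qed simp
  finally show ?thesis .
qed

section \<open>Comparison of the two coefficient formulas\<close>

theorem theorem1:
  fixes n N :: nat and k \<phi> \<theta> :: real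
  assumes "n \<ge> 3" and "k > 0"
    and "\<phi> \<in> {0..pi / real n}" and "\<theta> \<in> {0..pi / real n}"
  shows "S_sum N n k \<phi> \<theta> =
    2 ^ N / Gamma (real n * k + real N) *
    (\<Sum>m \<in> compositions n N. \<Sum>j = 0..Min (m ` {1..n}).
       pochhammer k j * pochhammer k j / (pochhammer (2 * k) j * fact j) *
       (- (2 powi (2 - int n)) * sin (real n * \<theta>) * sin (real n * \<phi>)) ^ j *
       (\<Prod>s = 1..n. pochhammer (k + real j) (m s - j) / fact (m s - j) *
          b_coeff (\<theta> - \<phi>) n s ^ (m s - j)))"
    (is "_ = _ * ?R")
proof -
  have "n > 0" using assms by simp
  define K where "K = complex_of_real k"
  define W :: "complex fps" where "W = 1 + fps_X ^ 2"
  define x where "x = real n * \<phi>"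
  define y where "y = real n * \<theta>"
  define b where "b = (\<lambda>s. complex_of_real (b_coeff (\<theta> - \<phi>) n s))"
  define A where "A = - (2 powi (2 - int n)) * sin y * sin x"
  define F where "F = Abs_fps (\<lambda>i. pochhammer K i ^ 2 / (pochhammer (2 * K) i * fact i))"
  define P where "P = (\<Prod>s = 1..n. 1 - fps_const (b s) * fps_X)"
  define Q where "Q = (1 - fps_const (cis (y - x)) * fps_X) * (1 - fps_const (cis (x - y)) * fps_X)"
  define \<tau> where "\<tau> = fps_const 2 * fps_X * inverse W"
  define H where "H = fps_cpow (- K) P * (F oo (fps_const (of_real A) * fps_X ^ n * inverse P))"
  define G where "G = Abs_fps (\<lambda>j. complex_of_real (gegenbauer k j (cos x) * gegenbauer k j (cos y) / gegenbauer k j 1))"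
  have W0: "fps_nth W 0 = 1" and Q0: "fps_nth Q 0 = 1" and P0: "fps_nth P 0 = 1"
    by (simp_all add: W_def Q_def P_def fps_prod_nth_0)

  \<comment> \<open>The 2^n produced by the substitution turns 2^(2-n) into the 4 of the product
    formula.\<close>
  have "2 powi (2 - int n) * 2 ^ n = (4 :: real)"
    by (simp add: power_int_diff)
  then have "A * 2 ^ n = - 4 * sin x * sin y"
    by (simp add: A_def algebra_simps)
  then have "complex_of_real (A * 2 ^ n) = of_real (- 4 * sin x * sin y)"
    by (simp only:)
  then have A: "complex_of_real A * 2 ^ n = - 4 * of_real (sin x) * of_real (sin y)"
    by simp
  have G: "G = fps_cpow (- K) Q * (F oo (fps_const (of_real A * 2 ^ n) * fps_X * inverse Q))"
    unfolding G_def A F_def K_def Q_def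
    by (rule fps_ext) (simp only: fps_nth_Abs_fps gegenbauer_product_nth[OF \<open>k > 0\<close>])
  have "W ^ n * (P oo \<tau>) = Q oo fps_X ^ n"
    using b_coeff_prod_substitution[OF \<open>n > 0\<close>, of "\<theta> - \<phi>"]
    by (simp add: W_def P_def b_def Q_def \<tau>_def x_def y_def right_diff_distrib)
  then have "H oo \<tau> = fps_cpow (of_nat n * K) W * (G oo fps_X ^ n)"
    unfolding H_def G \<tau>_def using \<open>n > 0\<close> W0 P0 Q0 by (intro fps_cpow_substitution)
  \<comment> \<open>The exponent in \<open>S_sum_eq_fps_nth\<close> splits into
    \<open>N - 1\<close>, the Lagrange weight, and \<open>n * K\<close>, which the substitution in
    \<open>H\<close> absorbs.\<close>
  moreover have "fps_cpow (of_nat n * K + of_nat N - 1) W =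
      fps_cpow (of_nat N - 1) W * fps_cpow (of_nat n * K) W"
    using W0 by (simp add: algebra_simps flip: fps_cpow_add)
  ultimately have "fps_cpow (of_nat n * K + of_nat N - 1) W * (1 - fps_X ^ 2) * (G oo fps_X ^ n) =
      fps_cpow (of_nat N - 1) W * (1 - fps_X ^ 2) * (H oo \<tau>)"
    by (simp add: mult_ac)
  then have "complex_of_real (Gamma (real n * k + real N) * S_sum N n k \<phi> \<theta>) =
      fps_nth (fps_cpow (of_nat N - 1) W * (1 - fps_X ^ 2) * (H oo \<tau>)) N"
    using S_sum_eq_fps_nth[OF \<open>n > 0\<close> \<open>k > 0\<close>, of N \<phi> \<theta>]
    by (simp only: W_def G_def K_def x_def y_def)
  also have "\<dots> = 2 ^ N * fps_nth H N"
    unfolding W_def \<tau>_def by (rule fps_lagrange_one_plus_X2)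
  also have "fps_nth H N = complex_of_real ?R"
  proof -
    have K: "pochhammer (K + of_nat j) i = of_real (pochhammer (k + real j) i)"
      "pochhammer K i = of_real (pochhammer k i)"
      "pochhammer (2 * K) i = of_real (pochhammer (2 * k) i)" for i j
      by (simp_all add: K_def flip: pochhammer_of_real)
    have "fps_nth H N = (\<Sum>m\<in>compositions n N. \<Sum>j = 0..Min (m ` {1..n}).
       fps_nth F j * of_real A ^ j *
       (\<Prod>s = 1..n. pochhammer (K + of_nat j) (m s - j) / fact (m s - j) * b s ^ (m s - j)))"
      unfolding H_def P_def by (rule composition_sum_eq_fps_nth) fact
    also have "\<dots> = complex_of_real (\<Sum>m \<in> compositions n N. \<Sum>j = 0..Min (m ` {1..n}).
       pochhammer k j * pochhammer k j / (pochhammer (2 * k) j * fact j) * A ^ j *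
       (\<Prod>s = 1..n. pochhammer (k + real j) (m s - j) / fact (m s - j) *
          b_coeff (\<theta> - \<phi>) n s ^ (m s - j)))"
      by (simp add: F_def K b_def power2_eq_square)
    finally show ?thesis by (simp only: A_def x_def y_def)
  qed
  finally have "complex_of_real (Gamma (real n * k + real N) * S_sum N n k \<phi> \<theta>) = of_real (2 ^ N * ?R)"
    by simp
  then have "Gamma (real n * k + real N) * S_sum N n k \<phi> \<theta> = 2 ^ N * ?R"
    by (simp only: of_real_eq_iff)
  moreover have "Gamma (real n * k + real N) > 0"
    using \<open>n > 0\<close> \<open>k > 0\<close> by (simp add: add_pos_nonneg)
  ultimately show ?thesis by (simp add: field_simps)
qed

end
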